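(* Let $n\ge 3$ be an odd integer. Let $m\ge 1$ be an odd integer and $t\ge 2$ an even integer admitting factorizations $$m=m_0\Big(\prod_{i=1}^{r_1}m_i\Big)\Big(\prod_{i=1}^{q_1}m_i'\Big),\qquad t=t_0\Big(\prod_{i=1}^{r_2}t_i\Big)\Big(\prod_{i=1}^{q_2}t_i'\Big),$$ where $r_1,q_1,r_2,q_2\ge 0$ and $m_0,t_0\ge 1$ are integers, $m_1,\ldots,m_{r_1},t_1,\ldots,t_{r_2}$ are odd primes, and $m_1',\ldots,m_{q_1}',t_1',\ldots,t_{q_2}'\ge 2$ are integers. Suppose that there exist even divisors $d_i$ of $m_i-1$ ($1\le i\le r_1$), even divisors $d_j'$ of $t_j-1$ ($1\le j\le r_2$), and $\kappa\in\{2,4\}$ such that $$\kappa\Big(\prod_{i=1}^{r_1}d_i\Big)\Big(\prod_{j=1}^{r_2}d_j'\Big)\Big(\prod_{i=1}^{q_1}(m_i'-1)\Big)\Big(\prod_{i=1}^{q_2}(t_i'-1)\Big)=mt$$ and $$t+2\Big(\prod_{i=1}^{r_1}d_i\Big)\Big(\prod_{i=1}^{q_1}(m_i'-1)\Big)\ne m+\frac{\kappa}{2}\Big(\prod_{j=1}^{r_2}d_j'\Big)\Big(\prod_{i=1}^{q_2}(t_i'-1)\Big).$$ Then there exists a nut graph with $(o_v,o_e)=(2,3)$ of order $n(m+t)$. In particular, for every odd integer $n\ge 3$ there exists a nut graph with $(o_v,o_e)=(2,3)$ of order $ns$ for each $$s\in\{3,5,7,11,13,29,31,37,41,47,53,5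9,83,101,103,109,127,131,137,139\}.$$
   Context: A nut graph is a finite simple graph whose adjacency matrix has a one-dimensional null space spanned by a vector with no zero entries. For a graph $\Gamma$, $o_v$ and $o_e$ denote the numbers of orbits of $\mathrm{Aut}(\Gamma)$ on the vertex set and on the edge set of $\Gamma$, respectively. Empty products equal $1$. *)

theory Defs
  imports
    "HOL-Computational_Algebra.Primes"
    "HOL-Algebra.Group_Action"
    "Jordan_Normal_Form.Matrix_Kernel"
begin

definition finite_simple_graph :: "'a set \<Rightarrow> 'a set set \<Rightarrow> bool" where
  "finite_simple_graph V E \<longleftrightarrow> finite V \<and> (\<forall>e\<in>E. e \<subseteq> V \<and> card e = 2)"

definition adj_matrix :: "'a list \<Rightarrow> 'a set set \<Rightarrow> real mat" where
  "adj_matrix vs E =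
     mat (length vs) (length vs) (\<lambda>(i, j). if {vs ! i, vs ! j} \<in> E then 1 else 0)"

(* Two enumerations vs of V give adjacency matrices conjugate by a permutation matrix, so
   the property does not depend on the choice of vs. *)
definition nut_graph :: "'a set \<Rightarrow> 'a set set \<Rightarrow> bool" where
  "nut_graph V E \<longleftrightarrow> finite_simple_graph V E \<and>
     (\<exists>vs. distinct vs \<and> set vs = V \<and>
        kernel_dim (adj_matrix vs E) = 1 \<and>
        (\<exists>x \<in> carrier_vec (length vs).
           mat_kernel (adj_matrix vs E) = {c \<cdot>\<^sub>v x | c. True} \<and>
           (\<forall>i < length vs. x $ i \<noteq> 0)))"

(* Elements of BijGroup V are extensional, i.e. undefined outside V, so each automorphism
   is represented by exactly one function. *)
definition graph_aut :: "'a set \<Rightarrow> 'a set set \<Rightarrow> ('a \<Rightarrow> 'a) monoid" where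
  "graph_aut V E = (BijGroup V)
     \<lparr>carrier := {f \<in> Bij V. \<forall>u\<in>V. \<forall>v\<in>V. {f u, f v} \<in> E \<longleftrightarrow> {u, v} \<in> E}\<rparr>"

definition num_vertex_orbits :: "'a set \<Rightarrow> 'a set set \<Rightarrow> nat" where
  "num_vertex_orbits V E = card (orbits (graph_aut V E) V (\<lambda>f. f))"

definition num_edge_orbits :: "'a set \<Rightarrow> 'a set set \<Rightarrow> nat" where
  "num_edge_orbits V E = card (orbits (graph_aut V E) E (\<lambda>f e. f ` e))"

end

theory Submission
  imports
    "HOL-Number_Theory.Number_Theory"
    "Jordan_Normal_Form.Char_Poly"
    Defs
    "HOL-Library.Countable"
begin

text \<open>
Let \<open>D\<close> and \<open>e\<close> be the products over the \<open>m\<close>-side and the \<open>t\<close>-side valencies, so that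
\<open>\<kappa> D e = m t\<close>.  The factorizations of \<open>m\<close> and \<open>t\<close> provide relations \<open>R\<close> on an \<open>m\<close>-set \<open>M\<close> and \<open>S\<close>
on a \<open>t\<close>-set \<open>T\<close> that are symmetric, regular of valencies \<open>D\<close> and \<open>e\<close>, transitive on arcs, and have
nonsingular adjacency matrices.  They are tensor products of an identity relation on \<open>m\<^sub>0\<close> or \<open>t\<^sub>0\<close> points,
of circulants of prime order \<open>p\<close> whose connection set is the subgroup of order \<open>d\<close> of the units modulo
\<open>p\<close>, and of complete graphs.  Loops in \<open>R\<close> are harmless, because \<open>R\<close> is only used between different
fibres; the same holds for \<open>S\<close> if \<open>\<kappa> = 4\<close>, while \<open>S\<close> is chosen loopless if \<open>\<kappa> = 2\<close>.

The graph has the vertices \<open>(i, x)\<close> with \<open>i\<close> in an \<open>n\<close>-cycle and \<open>x\<close> in the disjoint union of \<open>M\<close> and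
\<open>T\<close>.  Inside a fibre, every point of \<open>M\<close> is joined to every point of \<open>T\<close>; points of \<open>M\<close> in consecutive
fibres are joined according to \<open>R\<close>; points of \<open>T\<close> are joined according to \<open>S\<close>, in consecutive fibres
if \<open>\<kappa> = 4\<close> and inside each fibre if \<open>\<kappa> = 2\<close>.

Nut property: for a null vector, nonsingularity of \<open>R\<close> makes the sum over the two neighbouring
fibres independent of the point of \<open>M\<close>, and the adjacency operator of an odd cycle is injective, so the vector
takes a single value \<open>\<alpha> i\<close> on the copy of \<open>M\<close> in fibre \<open>i\<close>, and similarly a value \<open>\<beta> i\<close> on that of \<open>T\<close>
(\<open>kernel_values\<close>).  Eliminating \<open>\<beta>\<close> turns \<open>\<kappa> D e = m t\<close> into \<open>C \<alpha> = 2 \<alpha>\<close> or \<open>C\<^sup>2 \<alpha> = 4 \<alpha>\<close> for the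
cycle operator \<open>C\<close>, and on an odd cycle only constants satisfy this (\<open>fibre_values_constant\<close>).  Hence
the null space is spanned by the vector with entries \<open>t\<close> on \<open>M\<close> and \<open>-2 D\<close> on \<open>T\<close>.

Orbits: rotations of the cycle together with automorphisms of \<open>R\<close> and of \<open>S\<close> act transitively on the
\<open>M\<close>-vertices, on the \<open>T\<close>-vertices and on the three kinds of edges (\<open>M\<close>-\<open>M\<close>, \<open>T\<close>-\<open>T\<close>, \<open>M\<close>-\<open>T\<close>).  These
classes do not merge further, since the two kinds of vertices have the degrees \<open>t + 2 D\<close> and
\<open>m + (\<kappa> div 2) e\<close>, which differ by assumption.

The arithmetic core is the nonsingularity of the circulants: their eigenvalues are sums \<open>\<Sum>h\<in>H. z ^ h\<close>
with \<open>z ^ p = 1\<close>, and such a sum is nonzero when \<open>p\<close> does not divide the size of \<open>H\<close>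
(\<open>sum_powers_root_of_unity_nonzero\<close>).
\<close>

section \<open>Sums of powers of a root of unity of prime order\<close>

text \<open>
The Frobenius congruence, in a form that applies to the ring of integer polynomials.
\<close>
lemma prime_dvd_sum_power_diff:
  fixes a :: "'b \<Rightarrow> 'a::comm_ring_1"
  assumes p: "prime p" and fin: "finite A"
  shows "of_nat p dvd (\<Sum>i\<in>A. a i) ^ p - (\<Sum>i\<in>A. a i ^ p)"
  using fin
proof (induction A rule: finite_induct)
  case empty
  then show ?case using prime_gt_0_nat[OF p] by (simp add: power_0_left)
next
  case (insert x F)
  let ?s = "\<Sum>i\<in>F. a i"
  have binom: "of_nat p dvd (u + v) ^ p - u ^ p - v ^ p" for u v :: 'a
  proof -
    have "(u + v) ^ p = (\<Sum>k\<le>p. of_nat (p choose k) * u ^ k * v ^ (p - k))"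
      by (rule binomial_ring)
    also have "{..p} = insert 0 (insert p {0<..<p})"
      by auto
    also have "(\<Sum>k\<in>\<dots>. of_nat (p choose k) * u ^ k * v ^ (p - k)) =
      v ^ p + (u ^ p + (\<Sum>k\<in>{0<..<p}. of_nat (p choose k) * u ^ k * v ^ (p - k)))"
      using prime_gt_0_nat[OF p] by simp
    finally have eq: "(u + v) ^ p - u ^ p - v ^ p =
      (\<Sum>k\<in>{0<..<p}. of_nat (p choose k) * u ^ k * v ^ (p - k))"
      by simp
    have "of_nat p dvd of_nat (p choose k) * u ^ k * v ^ (p - k)" if "k \<in> {0<..<p}" for k
    proof -
      have "p dvd (p choose k)"
        using that p by (intro dvd_choose_prime) auto
      then have "(of_nat p :: 'a) dvd of_nat (p choose k)"
        by (auto simp: dvd_def)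
      then show ?thesis by (simp add: mult.assoc)
    qed
    then show ?thesis unfolding eq by (rule dvd_sum)
  qed
  have "(\<Sum>i\<in>insert x F. a i) ^ p - (\<Sum>i\<in>insert x F. a i ^ p) =
    ((a x + ?s) ^ p - a x ^ p - ?s ^ p) + (?s ^ p - (\<Sum>i\<in>F. a i ^ p))"
    using insert.hyps by simp
  then show ?case using dvd_add[OF binom insert.IH] by metis
qed

lemma power_mod_root_of_unity:
  fixes z :: "'a::monoid_mult"
  assumes "z ^ n = 1"
  shows "z ^ (l mod n) = z ^ l"
proof -
  have "z ^ l = z ^ (n * (l div n) + l mod n)" by simp
  also have "\<dots> = z ^ (l mod n)"
    by (simp only: power_add power_mult assms power_one mult_1_left)
  finally show ?thesis by simp
qed

text \<open>
Multiplication by \<open>g(z)\<close> maps the lattice spanned by \<open>1, z, \<dots>, z\<^sup>n\<^sup>-\<^sup>1\<close> into itself, so \<open>g(z)\<close> is an eigenvalue of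
an integer matrix and a root of its monic characteristic polynomial.
\<close>
lemma algebraic_int_poly_root_of_unity:
  fixes z :: complex
  assumes z: "z ^ n = 1" and n: "n > 0"
  shows "algebraic_int (poly (of_int_poly g) z)"
proof -
  let ?w = "poly (of_int_poly g) z"
  define C :: "int mat" where
    "C = mat n n (\<lambda>(j, k). \<Sum>i\<le>degree g. if (i + j) mod n = k then coeff g i else 0)"
  define v where "v = vec n (\<lambda>j. z ^ j)"
  have C: "C \<in> carrier_mat n n" by (simp add: C_def)
  note zmod = power_mod_root_of_unity[OF z]
  have "map_mat of_int C *\<^sub>v v = ?w \<cdot>\<^sub>v v"
  proof (rule eq_vecI)
    fix j assume j: "j < dim_vec (?w \<cdot>\<^sub>v v)"
    then have j': "j < n" by (simp add: v_def)
    have "(map_mat of_int C *\<^sub>v v) $ j =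
      (\<Sum>k<n. (\<Sum>i\<le>degree g. if (i + j) mod n = k then of_int (coeff g i) * z ^ k else 0))"
      using j' by (simp add: C_def v_def scalar_prod_def sum_distrib_right atLeast0LessThan
          of_int_sum if_distrib[of of_int] if_distrib[of "\<lambda>x. x * _"] cong: if_cong)
    also have "\<dots> = (\<Sum>i\<le>degree g. \<Sum>k<n. if (i + j) mod n = k then of_int (coeff g i) * z ^ k else 0)"
      by (rule sum.swap)
    also have "\<dots> = (\<Sum>i\<le>degree g. of_int (coeff g i) * z ^ ((i + j) mod n))"
      using n by (intro sum.cong refl) simp
    also have "\<dots> = ?w * z ^ j"
      by (simp add: zmod power_add poly_altdef sum_distrib_right mult.assoc)
    finally show "(map_mat of_int C *\<^sub>v v) $ j = (?w \<cdot>\<^sub>v v) $ j"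
      using j' by (simp add: v_def)
  qed (simp add: C_def v_def)
  moreover have "v \<noteq> 0\<^sub>v n"
  proof
    assume "v = 0\<^sub>v n"
    then have "v $ 0 = 0" using n by simp
    then show False using n by (simp add: v_def)
  qed
  ultimately have "eigenvalue (map_mat of_int C) ?w"
    unfolding eigenvalue_def eigenvector_def using C by (auto simp: v_def intro!: exI[of _ v])
  then have "poly (char_poly (map_mat of_int C)) ?w = 0"
    using eigenvalue_root_char_poly[of "map_mat of_int C" n ?w] C by simp
  then have "poly (of_int_poly (char_poly C)) ?w = 0"
    by (simp add: of_int_hom.char_poly_hom[OF C])
  moreover have "lead_coeff (char_poly C) = 1"
    using degree_monic_char_poly[OF C] by simp
  ultimately show ?thesis
    unfolding algebraic_int_altdef_ipoly by auto
qed

text \<open>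
By the Frobenius congruence, the \<open>p\<close>-th power of the sum is \<open>|H| + p g(z)\<close> with an integer polynomial
\<open>g\<close>.  If the sum vanished, the algebraic integer \<open>g(z)\<close> would equal the rational number \<open>- |H| / p\<close>,
which would then be an integer.
\<close>
lemma sum_powers_root_of_unity_nonzero:
  fixes z :: complex
  assumes p: "prime p" and z: "z ^ p = 1" and fin: "finite H" and d: "\<not> p dvd card H"
  shows "(\<Sum>h\<in>H. z ^ h) \<noteq> 0"
proof
  assume zero: "(\<Sum>h\<in>H. z ^ h) = 0"
  obtain g where g: "(\<Sum>h\<in>H. monom (1::int) h) ^ p - (\<Sum>h\<in>H. monom 1 h ^ p) = of_nat p * g"
    using prime_dvd_sum_power_diff[OF p fin, of "monom (1::int)"] by (auto simp: dvd_def)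
  let ?e = "\<lambda>q. poly (of_int_poly q) z"
  have "?e ((\<Sum>h\<in>H. monom (1::int) h) ^ p - (\<Sum>h\<in>H. monom 1 h ^ p)) =
    (\<Sum>h\<in>H. z ^ h) ^ p - (\<Sum>h\<in>H. (z ^ p) ^ h)"
    by (simp add: hom_distribs poly_sum poly_monom of_int_poly_hom.hom_sum power_mult[symmetric] mult.commute)
  also have "\<dots> = - of_nat (card H)"
    using prime_gt_0_nat[OF p] by (simp add: zero z)
  finally have eq: "of_nat p * ?e g = - of_nat (card H)"
    unfolding g by (simp add: hom_distribs)
  have p0: "(of_nat p :: complex) \<noteq> 0" using prime_gt_0_nat[OF p] by simp
  have val: "?e g = - of_nat (card H) / of_nat p"
    using eq p0 by (simp add: field_simps)
  then have "?e g \<in> \<rat>" by (simp)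
  moreover have "algebraic_int (?e g)"
    using algebraic_int_poly_root_of_unity[OF z prime_gt_0_nat[OF p]] .
  ultimately have "?e g \<in> \<int>" by (rule rational_algebraic_int_is_int[rotated])
  then obtain k where "?e g = of_int k" by (auto elim: Ints_cases)
  with eq have "(of_int (int p * k) :: complex) = of_int (- int (card H))" by simp
  then have "int p * k = - int (card H)" by (simp only: of_int_eq_iff)
  then have "int p dvd int (card H)" by (metis dvd_minus_iff dvd_triv_left)
  with d show False by simp
qed

section \<open>Arc-transitive nonsingular relations\<close>

definition relation_auts :: "'a set \<Rightarrow> ('a \<Rightarrow> 'a \<Rightarrow> bool) \<Rightarrow> ('a \<Rightarrow> 'a) set" where
  "relation_auts X R = {g. bij_betw g X X \<and> (\<forall>u\<in>X. \<forall>v\<in>X. R (g u) (g v) \<longleftrightarrow> R u v)}"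

text \<open>
Loops are allowed, so that the identity relation qualifies with valency 1; it plays the role of the
factors \<open>m\<^sub>0\<close> and \<open>t\<^sub>0\<close>.  Nonsingularity is stated through the kernel of the adjacency operator, which
avoids choosing an enumeration of \<open>X\<close>.
\<close>
locale arc_transitive_nonsingular =
  fixes X :: "'a set" and R :: "'a \<Rightarrow> 'a \<Rightarrow> bool" and d :: nat
  assumes finite: "finite X"
    and valency_pos: "d > 0"
    and sym: "\<lbrakk>a \<in> X; b \<in> X; R a b\<rbrakk> \<Longrightarrow> R b a"
    and valency: "a \<in> X \<Longrightarrow> card {b \<in> X. R a b} = d"
    and arc_transitive:
      "\<lbrakk>a \<in> X; b \<in> X; R a b; a' \<in> X; b' \<in> X; R a' b'\<rbrakk>
        \<Longrightarrow> \<exists>g \<in> relation_auts X R. g a = a' \<and> g b = b'"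
    and nonsingular:
      "\<lbrakk>\<And>a. a \<in> X \<Longrightarrow> (\<Sum>b | b \<in> X \<and> R a b. x b) = (0::real); a \<in> X\<rbrakk> \<Longrightarrow> x a = 0"
begin

lemma neighbour_exists:
  assumes "a \<in> X"
  obtains b where "b \<in> X" "R a b"
proof -
  have "{b \<in> X. R a b} \<noteq> {}"
    using valency[OF assms] valency_pos by (metis card.empty less_irrefl)
  then show ?thesis using that by auto
qed

lemma vertex_transitive:
  assumes "a \<in> X" "a' \<in> X"
  shows "\<exists>g \<in> relation_auts X R. g a = a'"
  using arc_transitive neighbour_exists assms by metis

end

lemma transpose_aut:
  assumes "a \<in> X" "b \<in> X"
  shows "bij_betw (transpose a b) X X"
  using assms by (intro bij_betwI[where g = "transpose a b"]) (auto simp: transpose_def)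

lemma arc_transitive_nonsingular_eq:
  assumes "finite X"
  shows "arc_transitive_nonsingular X (=) 1"
proof
  fix a b a' b' assume "a \<in> X" "b \<in> X" "a = b" "a' \<in> X" "b' \<in> X" "a' = b'"
  then show "\<exists>g\<in>relation_auts X (=). g a = a' \<and> g b = b'"
    by (intro bexI[of _ "transpose a a'"])
      (auto simp: relation_auts_def transpose_aut transpose_eq_iff)
next
  fix a assume "a \<in> X"
  then have "{b \<in> X. a = b} = {a}" by auto
  then show "card {b \<in> X. a = b} = 1" by simp
next
  fix x :: "'a \<Rightarrow> real" and a
  assume *: "\<And>a. a \<in> X \<Longrightarrow> (\<Sum>b | b \<in> X \<and> a = b. x b) = 0" and a: "a \<in> X"
  have "{b \<in> X. a = b} = {a}" using a by auto
  then show "x a = 0" using *[OF a] by simp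
qed (use assms in auto)

text \<open>
Arc-transitivity is the 2-transitivity of the symmetric group.  If all sums over the complements of
single points vanish, then \<open>x\<close> is constant with value its own total \<open>s\<close>, so \<open>s = |X| s\<close> and \<open>s = 0\<close>.
\<close>
lemma arc_transitive_nonsingular_neq:
  assumes "finite X" and "card X \<ge> 2"
  shows "arc_transitive_nonsingular X (\<noteq>) (card X - 1)"
proof
  fix a b a' b' assume *: "a \<in> X" "b \<in> X" "a \<noteq> b" "a' \<in> X" "b' \<in> X" "a' \<noteq> b'"
  let ?t = "transpose a a'"
  let ?g = "transpose (?t b) b' \<circ> ?t"
  have t: "?t b \<in> X" using * by (auto simp: transpose_def)
  have bij: "bij_betw ?g X X"
    by (intro bij_betw_trans[OF transpose_aut transpose_aut] t *)
  then have "?g \<in> relation_auts X (\<noteq>)"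
    unfolding relation_auts_def by (auto simp: bij_betw_def inj_on_def)
  \<comment> \<open>The second transposition leaves \<open>a'\<close> in place, because \<open>a' = ?t a\<close> differs from \<open>?t b\<close> and \<open>b'\<close>.\<close>
  moreover have "?g a = a'" "?g b = b'"
    using * by (auto simp: transpose_def)
  ultimately show "\<exists>g\<in>relation_auts X (\<noteq>). g a = a' \<and> g b = b'" by blast
next
  fix a assume "a \<in> X"
  then have "{b \<in> X. a \<noteq> b} = X - {a}" by auto
  then show "card {b \<in> X. a \<noteq> b} = card X - 1" using \<open>a \<in> X\<close> by simp
next
  fix x :: "'a \<Rightarrow> real" and a
  assume *: "\<And>a. a \<in> X \<Longrightarrow> (\<Sum>b | b \<in> X \<and> a \<noteq> b. x b) = 0" and a: "a \<in> X"
  have all: "x b = (\<Sum>c\<in>X. x c)" if "b \<in> X" for b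
  proof -
    have "{c \<in> X. b \<noteq> c} = X - {b}" by auto
    then show ?thesis using *[OF that] sum.remove[OF assms(1) that, of x] by simp
  qed
  have "(\<Sum>b\<in>X. x b) = (\<Sum>b\<in>X. \<Sum>c\<in>X. x c)" by (rule sum.cong[OF refl all])
  also have "\<dots> = real (card X) * (\<Sum>c\<in>X. x c)" by simp
  finally have "(\<Sum>c\<in>X. x c) = 0" using assms(2) by simp
  then show "x a = 0" using all[OF a] by simp
qed (use assms in auto)

lemma sum_Collect_Times:
  fixes f :: "'a \<times> 'b \<Rightarrow> real"
  assumes "finite X" "finite Y"
  shows "(\<Sum>u | u \<in> X \<times> Y \<and> P (fst u) \<and> Q (snd u). f u) =
    (\<Sum>a | a \<in> X \<and> P a. \<Sum>b | b \<in> Y \<and> Q b. f (a, b))"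
proof -
  have "{u. u \<in> X \<times> Y \<and> P (fst u) \<and> Q (snd u)} = {a. a \<in> X \<and> P a} \<times> {b. b \<in> Y \<and> Q b}"
    by auto
  then show ?thesis by (simp add: sum.cartesian_product)
qed

text \<open>
A tensor product of injective operators is injective: apply nonsingularity of \<open>R\<close> to the partial
sums over \<open>Y\<close>, then nonsingularity of \<open>S\<close> to each row.  Arcs of the product are pairs of arcs, so
products of automorphisms move any arc to any other.
\<close>
lemma arc_transitive_nonsingular_tensor:
  assumes "arc_transitive_nonsingular X R d" "arc_transitive_nonsingular Y S e"
  shows "arc_transitive_nonsingular (X \<times> Y) (\<lambda>u v. R (fst u) (fst v) \<and> S (snd u) (snd v)) (d * e)"
proof -
  interpret R: arc_transitive_nonsingular X R d by fact
  interpret S: arc_transitive_nonsingular Y S e by fact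
  let ?T = "\<lambda>u v. R (fst u) (fst v) \<and> S (snd u) (snd v)"
  show ?thesis
  proof
    fix a b a' b'
    assume *: "a \<in> X \<times> Y" "b \<in> X \<times> Y" "?T a b" "a' \<in> X \<times> Y" "b' \<in> X \<times> Y" "?T a' b'"
    obtain g where g: "g \<in> relation_auts X R" "g (fst a) = fst a'" "g (fst b) = fst b'"
      using R.arc_transitive[of "fst a" "fst b" "fst a'" "fst b'"] * by auto
    obtain h where h: "h \<in> relation_auts Y S" "h (snd a) = snd a'" "h (snd b) = snd b'"
      using S.arc_transitive[of "snd a" "snd b" "snd a'" "snd b'"] * by auto
    have "bij_betw (map_prod g h) (X \<times> Y) (X \<times> Y)"
      using g(1) h(1) by (intro bij_betw_map_prod) (auto simp: relation_auts_def)
    then have "map_prod g h \<in> relation_auts (X \<times> Y) ?T"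
      using g(1) h(1) by (auto simp: relation_auts_def)
    moreover have "map_prod g h a = a'" "map_prod g h b = b'"
      using g h by (auto simp: map_prod_def split: prod.splits)
    ultimately show "\<exists>g\<in>relation_auts (X \<times> Y) ?T. g a = a' \<and> g b = b'" by blast
  next
    fix a assume a: "a \<in> X \<times> Y"
    have "{b \<in> X \<times> Y. ?T a b} = {b \<in> X. R (fst a) b} \<times> {b \<in> Y. S (snd a) b}" by auto
    then show "card {b \<in> X \<times> Y. ?T a b} = d * e"
      using R.valency S.valency a by (auto simp: card_cartesian_product)
  next
    fix x :: "'a \<times> 'b \<Rightarrow> real" and u
    assume *: "\<And>a. a \<in> X \<times> Y \<Longrightarrow> (\<Sum>b | b \<in> X \<times> Y \<and> ?T a b. x b) = 0" and u: "u \<in> X \<times> Y"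
    have "(\<Sum>b | b \<in> Y \<and> S c b. x (a, b)) = 0" if c: "c \<in> Y" and a: "a \<in> X" for a c
    proof (rule R.nonsingular[OF _ a])
      fix a' assume a': "a' \<in> X"
      show "(\<Sum>a | a \<in> X \<and> R a' a. \<Sum>b | b \<in> Y \<and> S c b. x (a, b)) = 0"
        using *[of "(a', c)"] a' c sum_Collect_Times[OF R.finite S.finite] by simp
    qed
    then show "x u = 0"
      using S.nonsingular[of "\<lambda>b. x (fst u, b)" "snd u"] u by auto
    next
    show "finite (X \<times> Y)" "d * e > 0"
      using R.finite S.finite R.valency_pos S.valency_pos by simp_all
  next
    fix a b assume "a \<in> X \<times> Y" "b \<in> X \<times> Y" "?T a b"
    then show "?T b a" by (simp add: mem_Times_iff R.sym S.sym)
  qed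
qed

text \<open>
Used to replace a product of two sets by an initial segment of the natural numbers of the same size.
\<close>
lemma arc_transitive_nonsingular_vimage:
  assumes "arc_transitive_nonsingular Y R d" and h: "bij_betw h X Y"
  shows "arc_transitive_nonsingular X (\<lambda>u v. R (h u) (h v)) d"
proof -
  interpret R: arc_transitive_nonsingular Y R d by fact
  have hY: "h u \<in> Y" if "u \<in> X" for u using h that by (auto simp: bij_betw_def)
  let ?k = "inv_into X h"
  have k: "bij_betw ?k Y X" using h by (rule bij_betw_inv_into)
  have kX: "?k v \<in> X" if "v \<in> Y" for v using k that by (auto simp: bij_betw_def)
  have hk: "h (?k v) = v" if "v \<in> Y" for v using h that by (simp add: bij_betw_inv_into_right)
  have kh: "?k (h u) = u" if "u \<in> X" for u using h that by (simp add: bij_betw_inv_into_left)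
  have nbij: "bij_betw h {v \<in> X. R (h u) (h v)} {w \<in> Y. R (h u) w}" for u
    using h hY kX hk kh by (intro bij_betwI[where g = ?k]) auto
  show ?thesis
  proof
    show "finite X" using h R.finite bij_betw_finite by blast
  next
    fix a b a' b'
    assume *: "a \<in> X" "b \<in> X" "R (h a) (h b)" "a' \<in> X" "b' \<in> X" "R (h a') (h b')"
    obtain g where g: "g \<in> relation_auts Y R" "g (h a) = h a'" "g (h b) = h b'"
      using R.arc_transitive[of "h a" "h b" "h a'" "h b'"] * hY by auto
    have gY: "g v \<in> Y" if "v \<in> Y" for v using g(1) that by (auto simp: relation_auts_def bij_betw_def)
    have "bij_betw (?k \<circ> g \<circ> h) X X"
      using g(1) h k by (auto simp: relation_auts_def intro!: bij_betw_trans)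
    then have "?k \<circ> g \<circ> h \<in> relation_auts X (\<lambda>u v. R (h u) (h v))"
      using g(1) hY gY hk by (auto simp: relation_auts_def)
    then show "\<exists>g\<in>relation_auts X (\<lambda>u v. R (h u) (h v)). g a = a' \<and> g b = b'"
      using g kh * by (intro bexI[of _ "?k \<circ> g \<circ> h"]) auto
  next
    fix a assume "a \<in> X"
    then show "card {b \<in> X. R (h a) (h b)} = d"
      using bij_betw_same_card[OF nbij[of a]] R.valency[OF hY] by simp
  next
    fix x :: "'b \<Rightarrow> real" and a
    assume *: "\<And>a. a \<in> X \<Longrightarrow> (\<Sum>b | b \<in> X \<and> R (h a) (h b). x b) = 0" and a: "a \<in> X"
    have "(x \<circ> ?k) (h a) = 0"
    proof (rule R.nonsingular[OF _ hY[OF a]])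
      fix v assume v: "v \<in> Y"
      have "(\<Sum>w | w \<in> Y \<and> R v w. (x \<circ> ?k) w) = (\<Sum>b | b \<in> X \<and> R v (h b). (x \<circ> ?k) (h b))"
        using sum.reindex_bij_betw[OF nbij[of "?k v"], of "x \<circ> ?k"] hk[OF v] by simp
      also have "\<dots> = (\<Sum>b | b \<in> X \<and> R v (h b). x b)"
        by (intro sum.cong) (auto simp: kh)
      finally show "(\<Sum>w | w \<in> Y \<and> R v w. (x \<circ> ?k) w) = 0"
        using *[OF kX[OF v]] hk[OF v] by simp
    qed
    then show "x a = 0" using kh[OF a] by simp
  qed (simp_all add: R.valency_pos R.sym hY)
qed

section \<open>Circulant relations of prime order\<close>

text \<open>
In terms of a primitive root \<open>g\<close> and \<open>p - 1 = d e\<close>, the solutions of \<open>h\<^sup>d = 1\<close> are the powers of \<open>g\<^sup>e\<close>.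
\<close>
lemma card_power_roots_mod_prime:
  assumes p: "prime p" and d: "d dvd p - 1" "d > 0"
  shows "card {h \<in> {..<p}. [h ^ d = 1] (mod p)} = d"
proof -
  have p1: "p > 1" using p prime_gt_1_nat by blast
  obtain g where g: "residue_primroot p g"
    using prime_primitive_root_exists[of p] p p1 by auto
  have tot: "totient p = p - 1" using p by (rule totient_prime)
  have bij: "bij_betw (\<lambda>i. g ^ i mod p) {..<p - 1} {0<..<p}"
    using residue_primroot_is_generator[OF p1 g] tot totatives_prime[OF p] by simp
  obtain e where e: "p - 1 = d * e" using d(1) by (auto elim: dvdE)
  have e0: "e > 0" using e p1 by (cases e) auto
  have root: "[(g ^ i mod p) ^ d = 1] (mod p) \<longleftrightarrow> e dvd i" for i
  proof -
    have "[(g ^ i mod p) ^ d = 1] (mod p) \<longleftrightarrow> [g ^ (i * d) = 1] (mod p)"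
      by (simp add: cong_def power_mod power_mult)
    also have "\<dots> \<longleftrightarrow> ord p g dvd i * d" by (rule ord_divides)
    also have "ord p g = d * e" using g tot e by (simp add: residue_primroot_def)
    also have "i * d = d * i" by (rule mult.commute)
    finally show ?thesis using d(2) by simp
  qed
  have img: "{h \<in> {..<p}. [h ^ d = 1] (mod p)} = (\<lambda>i. g ^ i mod p) ` {i \<in> {..<p - 1}. e dvd i}"
  proof (intro Set.set_eqI iffI)
    fix h assume h: "h \<in> {h \<in> {..<p}. [h ^ d = 1] (mod p)}"
    then have "h \<noteq> 0" using d(2) p1 by (auto simp: cong_def power_0_left intro!: Nat.gr0I)
    with h have "h \<in> (\<lambda>i. g ^ i mod p) ` {..<p - 1}"
      using bij by (auto simp: bij_betw_def)
    with h root show "h \<in> (\<lambda>i. g ^ i mod p) ` {i \<in> {..<p - 1}. e dvd i}" by auto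
  next
    fix h assume "h \<in> (\<lambda>i. g ^ i mod p) ` {i \<in> {..<p - 1}. e dvd i}"
    then show "h \<in> {h \<in> {..<p}. [h ^ d = 1] (mod p)}" using root p1 by auto
  qed
  have mult: "{i \<in> {..<p - 1}. e dvd i} = (\<lambda>k. e * k) ` {..<d}"
    using e e0 by (auto simp: mult.commute elim!: dvdE)
  have "inj_on (\<lambda>i. g ^ i mod p) {i \<in> {..<p - 1}. e dvd i}"
    using bij by (auto simp: bij_betw_def intro: inj_on_subset)
  then have "card {h \<in> {..<p}. [h ^ d = 1] (mod p)} = card ((\<lambda>k. e * k) ` {..<d})"
    unfolding img mult[symmetric] by (rule card_image)
  also have "\<dots> = d"
    using e0 by (subst card_image) (auto simp: inj_on_def)
  finally show ?thesis .
qed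

text \<open>
Injectivity of the discrete Fourier transform: a polynomial of degree less than \<open>n\<close> with \<open>n\<close> roots is zero.
\<close>
lemma vanishing_at_roots_of_unity:
  fixes x :: "nat \<Rightarrow> complex"
  assumes "\<And>z. z ^ n = 1 \<Longrightarrow> (\<Sum>b<n. x b * z ^ b) = 0" and a: "a < n"
  shows "x a = 0"
proof -
  define P where "P = (\<Sum>b<n. monom (x b) b)"
  have coeff: "coeff P a = x a"
    unfolding P_def using a by (simp add: coeff_sum)
  have "P = 0"
  proof (rule ccontr)
    assume P: "P \<noteq> 0"
    have "{z. z ^ n = 1} \<subseteq> {z. poly P z = 0}"
      using assms(1) by (auto simp: P_def poly_sum poly_monom)
    then have "card {z::complex. z ^ n = 1} \<le> card {z. poly P z = 0}"
      by (rule card_mono[OF poly_roots_finite[OF P]])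
    then have "n \<le> card {z. poly P z = 0}"
      using card_roots_unity_eq[of n] a by simp
    also have "\<dots> \<le> degree P" using P by (rule card_poly_roots_bound)
    also have "degree P < n"
      unfolding P_def using a
      by (intro degree_sum_less) (auto intro: le_less_trans[OF degree_monom_le])
    finally show False by simp
  qed
  then show ?thesis using coeff by simp
qed

lemma bij_betw_translate_mod:
  fixes Q :: "int \<Rightarrow> bool"
  assumes p: "p > 0" and a: "a < p" and Q: "\<And>u v. [u = v] (mod int p) \<Longrightarrow> Q u \<longleftrightarrow> Q v"
  shows "bij_betw (\<lambda>h. (a + h) mod p) {h \<in> {..<p}. Q (int h)} {b \<in> {..<p}. Q (int b - int a)}"
proof (rule bij_betwI[where g = "\<lambda>b. (b + (p - a)) mod p"])
  have 1: "[int ((a + h) mod p) - int a = int h] (mod int p)" for h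
    by (simp add: cong_def of_nat_mod mod_simps)
  have 2: "[int ((b + (p - a)) mod p) = int b - int a] (mod int p)" for b
  proof -
    have "int ((b + (p - a)) mod p) = (int b - int a + int p) mod int p"
      using a by (simp add: of_nat_mod of_nat_diff algebra_simps)
    then show ?thesis by (simp add: cong_def)
  qed
  show "(\<lambda>h. (a + h) mod p) \<in> {h \<in> {..<p}. Q (int h)} \<rightarrow> {b \<in> {..<p}. Q (int b - int a)}"
    using p Q[OF 1] by auto
  show "(\<lambda>b. (b + (p - a)) mod p) \<in> {b \<in> {..<p}. Q (int b - int a)} \<rightarrow> {h \<in> {..<p}. Q (int h)}"
    using p Q[OF 2] by auto
  show "((a + h) mod p + (p - a)) mod p = h" if "h \<in> {h \<in> {..<p}. Q (int h)}" for h
  proof -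
    have "((a + h) mod p + (p - a)) mod p = (a + h + (p - a)) mod p" by (simp add: mod_simps)
    also have "a + h + (p - a) = h + p" using a by simp
    finally show ?thesis using that by simp
  qed
  show "(a + (b + (p - a)) mod p) mod p = b" if "b \<in> {b \<in> {..<p}. Q (int b - int a)}" for b
  proof -
    have "(a + (b + (p - a)) mod p) mod p = (a + (b + (p - a))) mod p" by (simp add: mod_simps)
    also have "a + (b + (p - a)) = b + p" using a by simp
    finally show ?thesis using that by simp
  qed
qed

text \<open>
Joining \<open>a\<close> to \<open>b\<close> when \<open>b - a\<close> is a \<open>d\<close>-th root of unity modulo \<open>p\<close> makes every affine map
\<open>v \<mapsto> c v + k\<close> with \<open>c\<^sup>d = 1\<close> an automorphism, and these maps are transitive on arcs.  The relation is
symmetric because \<open>d\<close> is even.  The discrete Fourier transform diagonalizes the adjacency operator,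
with eigenvalues \<open>\<Sum>h\<in>H. z ^ h\<close> for \<open>z ^ p = 1\<close>; they are nonzero since \<open>0 < d < p\<close>.
\<close>
lemma arc_transitive_nonsingular_circulant:
  assumes p: "prime p" and d: "even d" "d dvd p - 1"
  shows "arc_transitive_nonsingular {..<p} (\<lambda>a b. [(int b - int a) ^ d = 1] (mod int p)) d"
proof -
  have p1: "p > 1" using p prime_gt_1_nat by blast
  have d0: "d > 0" using d(2) p1 by (auto intro!: Nat.gr0I)
  let ?R = "\<lambda>a b. [(int b - int a) ^ d = 1] (mod int p)"
  define H where "H = {h \<in> {..<p}. [int h ^ d = 1] (mod int p)}"
  have trans: "bij_betw (\<lambda>h. (a + h) mod p) H {b \<in> {..<p}. ?R a b}" if "a < p" for a
    unfolding H_def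
    using that p1 by (intro bij_betw_translate_mod) (auto intro: cong_trans cong_pow cong_sym)
  have sym: "?R a b \<longleftrightarrow> ?R b a" for a b
    using d(1) by (metis minus_diff_eq power_minus_even)
  have "H = {h \<in> {..<p}. [h ^ d = 1] (mod p)}"
    unfolding H_def by (simp add: cong_int_iff[symmetric])
  then have cardH: "card H = d"
    using card_power_roots_mod_prime[OF p d(2) d0] by simp
  have finH: "finite H" by (simp add: H_def)
  show ?thesis
  proof
    fix a b a' b'
    assume *: "a \<in> {..<p}" "b \<in> {..<p}" "?R a b" "a' \<in> {..<p}" "b' \<in> {..<p}" "?R a' b'"
    let ?u = "int b - int a" and ?u' = "int b' - int a'"
    \<comment> \<open>Since \<open>?u ^ d = 1\<close>, the power \<open>?u ^ (d - 1)\<close> is the inverse of \<open>?u\<close>, so \<open>c\<close> is the quotient \<open>?u' / ?u\<close>.\<close>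
    define c where "c = ?u' * ?u ^ (d - 1)"
    define g where "g v = nat ((c * (int v - int a) + int a') mod int p)" for v :: nat
    have g: "int (g v) = (c * (int v - int a) + int a') mod int p" for v
      using p1 by (simp add: g_def)
    have gp: "g v < p" for v
      using p1 by (simp add: g_def nat_less_iff)
    have cd: "[c ^ d = 1] (mod int p)"
    proof -
      have "c ^ d = ?u' ^ d * (?u ^ d) ^ (d - 1)"
        by (simp add: c_def power_mult_distrib flip: power_mult) (simp add: mult.commute)
      also have "[\<dots> = 1 * 1 ^ (d - 1)] (mod int p)"
        using *(3,6) by (intro cong_mult cong_pow)
      finally show ?thesis by simp
    qed
    have diff: "[int (g w) - int (g v) = c * (int w - int v)] (mod int p)" for v w
    proof -
      have "[int (g w) - int (g v) =
        (c * (int w - int a) + int a') - (c * (int v - int a) + int a')] (mod int p)"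
        unfolding g by (intro cong_diff) (simp_all add: cong_def)
      then show ?thesis by (simp add: algebra_simps)
    qed
    have Rg: "?R (g v) (g w) \<longleftrightarrow> ?R v w" for v w
    proof -
      have "[(int (g w) - int (g v)) ^ d = c ^ d * (int w - int v) ^ d] (mod int p)"
        using cong_pow[OF diff] by (simp add: power_mult_distrib)
      also have "[c ^ d * (int w - int v) ^ d = 1 * (int w - int v) ^ d] (mod int p)"
        using cd by (intro cong_mult cong_refl)
      finally show ?thesis by (simp add: cong_def)
    qed
    have "inj_on g {..<p}"
    proof (rule inj_onI)
      fix v w assume vw: "v \<in> {..<p}" "w \<in> {..<p}" "g v = g w"
      have "[int w - int v = c ^ d * (int w - int v)] (mod int p)"
        using cong_mult[OF cong_sym[OF cd] cong_refl] by simp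
      also have "c ^ d * (int w - int v) = c ^ (d - 1) * (c * (int w - int v))"
        using d0 by (simp only: mult.assoc[symmetric] power_minus_mult)
      also have "[\<dots> = c ^ (d - 1) * (int (g w) - int (g v))] (mod int p)"
        by (intro cong_mult cong_refl cong_sym[OF diff])
      finally have "[int w - int v = 0] (mod int p)"
        using vw(3) by simp
      then have "[int w = int v] (mod int p)"
        by (simp add: cong_diff_iff_cong_0)
      then have "[w = v] (mod p)" by (simp add: cong_int_iff)
      then show "v = w" using vw by (simp add: cong_def)
    qed
    moreover have "g ` {..<p} \<subseteq> {..<p}" using gp by auto
    ultimately have "bij_betw g {..<p} {..<p}"
      by (simp add: bij_betw_def endo_inj_surj)
    then have "g \<in> relation_auts {..<p} ?R"
      using Rg by (simp add: relation_auts_def)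
    moreover have "g a = a'" using * by (simp add: g_def)
    moreover have "g b = b'"
    proof -
      have "c * ?u = ?u' * ?u ^ d"
        using d0 unfolding c_def by (simp only: mult.assoc power_minus_mult)
      also have "[\<dots> = ?u' * 1] (mod int p)"
        using *(3) by (intro cong_mult cong_refl)
      finally have "[c * ?u + int a' = int b'] (mod int p)"
        using cong_add[OF _ cong_refl, of "c * ?u" ?u' "int p" "int a'"] by simp
      then have "int (g b) = int b'"
        using * by (simp add: g cong_def)
      then show ?thesis by simp
    qed
    ultimately show "\<exists>g\<in>relation_auts {..<p} ?R. g a = a' \<and> g b = b'" by blast
  next
    fix a assume "a \<in> {..<p}"
    then show "card {b \<in> {..<p}. ?R a b} = d"
      using bij_betw_same_card[OF trans[of a]] cardH by simp
  next
    fix x :: "nat \<Rightarrow> real" and a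
    assume *: "\<And>a. a \<in> {..<p} \<Longrightarrow> (\<Sum>b | b \<in> {..<p} \<and> ?R a b. x b) = 0" and a: "a \<in> {..<p}"
    have "(\<Sum>b<p. complex_of_real (x b) * z ^ b) = 0" if z: "z ^ p = 1" for z
    proof -
      note zmod = power_mod_root_of_unity[OF z]
      have inner: "(\<Sum>a<p. if ?R a b then z ^ a else 0) = z ^ b * (\<Sum>h\<in>H. z ^ h)" if "b < p" for b
      proof -
        have "(\<Sum>a<p. if ?R a b then z ^ a else 0) = (\<Sum>a | a \<in> {..<p} \<and> ?R b a. z ^ a)"
          by (subst sum.inter_filter[symmetric]) (auto simp: sym[of _ b])
        also have "\<dots> = (\<Sum>h\<in>H. z ^ ((b + h) mod p))"
          using sum.reindex_bij_betw[OF trans[OF that], of "\<lambda>a. z ^ a"] by simp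
        finally show ?thesis by (simp add: zmod power_add sum_distrib_left)
      qed
      have "0 = (\<Sum>a<p. z ^ a * of_real (\<Sum>b | b \<in> {..<p} \<and> ?R a b. x b))"
        using * by simp
      also have "\<dots> = (\<Sum>a<p. \<Sum>b<p. of_real (x b) * (if ?R a b then z ^ a else 0))"
      proof (intro sum.cong refl)
        fix a
        have "(\<Sum>b | b \<in> {..<p} \<and> ?R a b. x b) = (\<Sum>b<p. if ?R a b then x b else 0)"
          by (rule sum.inter_filter) simp
        then show "z ^ a * of_real (\<Sum>b | b \<in> {..<p} \<and> ?R a b. x b) =
          (\<Sum>b<p. of_real (x b) * (if ?R a b then z ^ a else 0))"
          by (auto simp: sum_distrib_left intro!: sum.cong)
      qed
      also have "\<dots> = (\<Sum>b<p. of_real (x b) * (\<Sum>a<p. if ?R a b then z ^ a else 0))"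
        by (subst sum.swap) (simp add: sum_distrib_left)
      also have "\<dots> = (\<Sum>b<p. of_real (x b) * z ^ b) * (\<Sum>h\<in>H. z ^ h)"
        by (simp add: inner sum_distrib_right mult.assoc)
      finally have "(\<Sum>b<p. of_real (x b) * z ^ b) * (\<Sum>h\<in>H. z ^ h) = 0" by simp
      moreover have "d \<le> p - 1" using d(2) p1 by (intro dvd_imp_le) auto
      then have "\<not> p dvd card H"
        unfolding cardH using d0 p1 by (auto dest: dvd_imp_le)
      then have "(\<Sum>h\<in>H. z ^ h) \<noteq> 0"
        by (rule sum_powers_root_of_unity_nonzero[OF p z finH])
      ultimately show ?thesis by simp
    qed
    then have "complex_of_real (x a) = 0"
      using vanishing_at_roots_of_unity[of p "\<lambda>b. complex_of_real (x b)" a] a by simp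
    then show "x a = 0" by simp
  next
    show "?R b a" if "?R a b" for a b using that sym by blast
  qed (use d0 in auto)
qed

section \<open>Graphs given by a symmetric relation\<close>

text \<open>
The kernel condition is expressed by functions on vertices and neighbourhood sums, so that a
construction of a nut graph need not refer to an enumeration of its vertices.
\<close>
lemma nut_graphI:
  fixes x :: "'a \<Rightarrow> real"
  assumes graph: "finite_simple_graph V E" and nonempty: "V \<noteq> {}"
    and nonzero: "\<And>v. v \<in> V \<Longrightarrow> x v \<noteq> 0"
    and ker: "\<And>y::'a \<Rightarrow> real. (\<forall>v\<in>V. (\<Sum>u | u \<in> V \<and> {v, u} \<in> E. y u) = 0) \<longleftrightarrow>
                (\<exists>c. \<forall>v\<in>V. y v = c * x v)"
  shows "nut_graph V E"
proof -
  have "finite V" using graph by (simp add: finite_simple_graph_def)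
  then obtain vs where vs: "distinct vs" "set vs = V"
    using finite_distinct_list by blast
  define N where "N = length vs"
  define A where "A = adj_matrix vs E"
  define X where "X = vec N (\<lambda>i. x (vs ! i))"
  have A: "A \<in> carrier_mat N N" by (simp add: A_def adj_matrix_def N_def)
  have X: "X \<in> carrier_vec N" by (simp add: X_def)
  have N: "N > 0" using nonempty vs(2) by (auto simp: N_def)
  have bij: "bij_betw ((!) vs) {..<N} V"
    using bij_betw_nth[OF vs(1)] vs(2) by (simp add: N_def)
  have row: "(A *\<^sub>v w) $ i = (\<Sum>u | u \<in> V \<and> {vs ! i, u} \<in> E. y u)"
    if i: "i < N" and w: "w \<in> carrier_vec N" and y: "\<And>j. j < N \<Longrightarrow> y (vs ! j) = w $ j" for w y i
  proof -
    have "(A *\<^sub>v w) $ i = (\<Sum>j<N. if {vs ! i, vs ! j} \<in> E then y (vs ! j) else 0)"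
      using i w y by (simp add: A_def adj_matrix_def N_def scalar_prod_def
          atLeast0LessThan if_distrib[of "\<lambda>a. a * _"] cong: if_cong)
    also have "\<dots> = (\<Sum>u\<in>V. if {vs ! i, u} \<in> E then y u else 0)"
      by (rule sum.reindex_bij_betw[OF bij])
    also have "\<dots> = (\<Sum>u | u \<in> V \<and> {vs ! i, u} \<in> E. y u)"
      using \<open>finite V\<close> by (simp add: sum.inter_filter)
    finally show ?thesis .
  qed
  have mem: "w \<in> mat_kernel A \<longleftrightarrow> (\<exists>c. w = c \<cdot>\<^sub>v X)" if w: "w \<in> carrier_vec N" for w
  proof -
    define y where "y = (\<lambda>u. w $ inv_into {..<N} ((!) vs) u)"
    have y: "y (vs ! j) = w $ j" if "j < N" for j
      using bij_betw_inv_into_left[OF bij] that by (simp add: y_def)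
    have V: "(\<forall>v\<in>V. P v) \<longleftrightarrow> (\<forall>i<N. P (vs ! i))" for P
      unfolding vs(2)[symmetric] N_def by (rule all_set_conv_all_nth)
    have "w \<in> mat_kernel A \<longleftrightarrow> (\<forall>i<N. (A *\<^sub>v w) $ i = 0)"
      using A w by (auto simp: mat_kernel[OF A] vec_eq_iff simp del: index_mult_mat_vec)
    also have "\<dots> \<longleftrightarrow> (\<forall>v\<in>V. (\<Sum>u | u \<in> V \<and> {v, u} \<in> E. y u) = 0)"
      by (simp add: V row[OF _ w y])
    also have "\<dots> \<longleftrightarrow> (\<exists>c. \<forall>i<N. w $ i = c * x (vs ! i))"
      unfolding ker V using y by auto
    also have "\<dots> \<longleftrightarrow> (\<exists>c. w = c \<cdot>\<^sub>v X)"
      using w by (auto simp: X_def vec_eq_iff)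
    finally show ?thesis .
  qed
  have kernel: "mat_kernel A = {c \<cdot>\<^sub>v X | c. True}"
    using mem mat_kernel_carrier[OF A] X by auto
  interpret K: kernel N N A using A by unfold_locales
  have XK: "{X} \<subseteq> mat_kernel A" using kernel by (auto intro: exI[of _ 1])
  have lin: "K.lincomb a {X} = a X \<cdot>\<^sub>v X" for a
  proof (rule eq_vecI)
    have "K.lincomb a {X} \<in> mat_kernel A"
      using XK by (intro K.Ker.lincomb_closed) auto
    then show "dim_vec (K.lincomb a {X}) = dim_vec (a X \<cdot>\<^sub>v X)"
      using mat_kernel_carrier[OF A] X by auto
    fix i assume "i < dim_vec (a X \<cdot>\<^sub>v X)"
    then show "K.lincomb a {X} $ i = (a X \<cdot>\<^sub>v X) $ i"
      using K.lincomb_index[OF _ XK, of i a] X by simp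
  qed
  have span: "K.span {X} = mat_kernel A"
  proof (rule subset_antisym)
    show "K.span {X} \<subseteq> mat_kernel A"
      using K.Ker.span_is_subset2[OF XK] by simp
    show "mat_kernel A \<subseteq> K.span {X}"
    proof
      fix w assume "w \<in> mat_kernel A"
      then obtain c where "w = c \<cdot>\<^sub>v X" using kernel by auto
      then have "w = K.lincomb (\<lambda>_. c) {X}" using lin by simp
      then show "w \<in> K.span {X}" unfolding K.Ker.span_def by auto
    qed
  qed
  have "K.basis {X}"
    unfolding K.Ker.basis_def
  proof (intro conjI)
    show "K.lin_indpt {X}"
    proof (rule K.Ker.finite_lin_indpt2)
      fix a assume "K.lincomb a {X} = 0\<^sub>v N"
      then have "(a X \<cdot>\<^sub>v X) $ 0 = 0\<^sub>v N $ 0" by (simp only: lin)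
      then have "a X * x (vs ! 0) = 0" using N by (simp add: X_def)
      moreover have "x (vs ! 0) \<noteq> 0"
        using nonzero vs(2) N by (auto simp: N_def)
      ultimately show "\<forall>v\<in>{X}. a v = 0" by simp
    qed (use XK in auto)
  qed (use span XK in auto)
  then have "kernel_dim A = 1"
    using K.Ker.dim_basis[of "{X}"] by simp
  moreover have "\<forall>i<length vs. X $ i \<noteq> 0"
    using nonzero vs(2) by (auto simp: X_def N_def)
  ultimately show ?thesis
    unfolding nut_graph_def using graph vs kernel X by (auto simp: A_def N_def)
qed

text \<open>
Orbits are counted by exhibiting an invariant colouring whose colour classes are orbits.
\<close>
lemma card_orbits_eq_card_colours:
  assumes act: "\<And>g v. \<lbrakk>g \<in> carrier G; v \<in> V\<rbrakk> \<Longrightarrow> \<phi> g v \<in> V \<and> c (\<phi> g v) = c v"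
    and trans: "\<And>u v. \<lbrakk>u \<in> V; v \<in> V; c u = c v\<rbrakk> \<Longrightarrow> \<exists>g\<in>carrier G. \<phi> g u = v"
  shows "card (orbits G V \<phi>) = card (c ` V)"
proof -
  have orb: "orbit G \<phi> v = {w \<in> V. c w = c v}" if "v \<in> V" for v
    using act trans[OF that] that by (fastforce simp: orbit_def)
  have "orbits G V \<phi> = (\<lambda>k. {w \<in> V. c w = k}) ` c ` V"
    using orb by (auto simp: orbits_def)
  moreover have "inj_on (\<lambda>k. {w \<in> V. c w = k}) (c ` V)"
    by (rule inj_onI) blast
  ultimately show ?thesis by (simp add: card_image)
qed

definition edge_set :: "'a set \<Rightarrow> ('a \<Rightarrow> 'a \<Rightarrow> bool) \<Rightarrow> 'a set set" where
  "edge_set V R = {{u, v} | u v. u \<in> V \<and> v \<in> V \<and> R u v}"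

lemma edge_set_iff:
  assumes "\<And>u v. \<lbrakk>u \<in> V; v \<in> V; R u v\<rbrakk> \<Longrightarrow> R v u"
  shows "{u, v} \<in> edge_set V R \<longleftrightarrow> u \<in> V \<and> v \<in> V \<and> R u v"
  using assms by (auto simp: edge_set_def doubleton_eq_iff)

lemma finite_simple_graph_edge_set:
  assumes "finite V" and "\<And>u. u \<in> V \<Longrightarrow> \<not> R u u"
  shows "finite_simple_graph V (edge_set V R)"
  using assms by (auto simp: finite_simple_graph_def edge_set_def card_insert_if)

lemma relation_aut_in_graph_aut:
  assumes "\<And>u v. \<lbrakk>u \<in> V; v \<in> V; R u v\<rbrakk> \<Longrightarrow> R v u" and g: "g \<in> relation_auts V R"
  shows "restrict g V \<in> carrier (graph_aut V (edge_set V R))"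
proof -
  have "g v \<in> V" if "v \<in> V" for v using g that by (auto simp: relation_auts_def bij_betw_def)
  then show ?thesis
    using g edge_set_iff[of V R, OF assms(1)]
    by (auto simp: graph_aut_def Bij_def relation_auts_def bij_betw_restrict_eq)
qed

lemma graph_aut_edge_set:
  assumes "\<And>u v. \<lbrakk>u \<in> V; v \<in> V; R u v\<rbrakk> \<Longrightarrow> R v u"
  shows "carrier (graph_aut V (edge_set V R)) = relation_auts V R \<inter> extensional V"
proof -
  have "g v \<in> V" if "bij_betw g V V" "v \<in> V" for g v using that by (auto simp: bij_betw_def)
  then show ?thesis
    using edge_set_iff[of V R, OF assms] by (auto simp: graph_aut_def Bij_def relation_auts_def)
qed

section \<open>Relabelling the vertices of a graph\<close>

text \<open>
The fibred graph is built on pairs and disjoint sums; the following lemmas carry its properties over to an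
isomorphic graph on natural numbers.
\<close>
lemma inj_image_operator: "inj f \<Longrightarrow> inj ((`) f)"
  by (rule injI) (simp add: inj_image_eq_iff)

lemma nut_graph_image:
  assumes f: "inj f" and nut: "nut_graph V E"
  shows "nut_graph (f ` V) ((`) f ` E)"
proof -
  have simple: "finite_simple_graph (f ` V) ((`) f ` E)"
    using nut f by (auto simp: nut_graph_def finite_simple_graph_def card_image inj_on_subset)
  have edge: "{f u, f v} \<in> (`) f ` E \<longleftrightarrow> {u, v} \<in> E" for u v
    using inj_image_mem_iff[OF inj_image_operator[OF f], of "{u, v}" E] by simp
  have adj: "adj_matrix (map f vs) ((`) f ` E) = adj_matrix vs E" for vs
    by (auto simp: adj_matrix_def edge)
  obtain vs x where vs: "distinct vs" "set vs = V" "kernel_dim (adj_matrix vs E) = 1"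
    "x \<in> carrier_vec (length vs)" "mat_kernel (adj_matrix vs E) = {c \<cdot>\<^sub>v x | c. True}"
    "\<forall>i < length vs. x $ i \<noteq> 0"
    using nut by (auto simp: nut_graph_def)
  show ?thesis
    unfolding nut_graph_def
  proof (intro conjI simple exI[of _ "map f vs"] bexI[of _ x])
    show "distinct (map f vs)" using vs(1) f by (auto simp: distinct_map intro: inj_on_subset)
  qed (use vs adj in auto)
qed

lemma graph_aut_image:
  assumes f: "inj f"
  shows "carrier (graph_aut (f ` V) ((`) f ` E)) =
    (\<lambda>g. restrict (f \<circ> g \<circ> inv_into UNIV f) (f ` V)) ` carrier (graph_aut V E)"
proof -
  let ?conj = "\<lambda>g. restrict (f \<circ> g \<circ> inv_into UNIV f) (f ` V)"
  have ff: "inv_into UNIV f (f x) = x" for x using f by simp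
  have edge: "{f u, f v} \<in> (`) f ` E \<longleftrightarrow> {u, v} \<in> E" for u v
    using inj_image_mem_iff[OF inj_image_operator[OF f], of "{u, v}" E] by simp
  have bf: "bij_betw f V (f ` V)" using f by (auto simp: bij_betw_def intro: inj_on_subset)
  have bi: "bij_betw (inv_into UNIV f) (f ` V) V"
    by (rule bij_betwI[where g = f]) (auto simp: ff)
  show ?thesis
  proof (rule subset_antisym)
    show "?conj ` carrier (graph_aut V E) \<subseteq> carrier (graph_aut (f ` V) ((`) f ` E))"
    proof
      fix h assume "h \<in> ?conj ` carrier (graph_aut V E)"
      then obtain g where g: "g \<in> carrier (graph_aut V E)" and h: "h = ?conj g" by blast
      have "bij_betw (f \<circ> g \<circ> inv_into UNIV f) (f ` V) (f ` V)"
        using g bf bi by (auto simp: graph_aut_def Bij_def intro!: bij_betw_trans)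
      then show "h \<in> carrier (graph_aut (f ` V) ((`) f ` E))"
        using g by (auto simp: h graph_aut_def Bij_def ff edge)
    qed
    show "carrier (graph_aut (f ` V) ((`) f ` E)) \<subseteq> ?conj ` carrier (graph_aut V E)"
    proof
      fix h assume h: "h \<in> carrier (graph_aut (f ` V) ((`) f ` E))"
      define g where "g = restrict (inv_into UNIV f \<circ> h \<circ> f) V"
      have hV: "h (f v) \<in> f ` V" if "v \<in> V" for v
        using h that by (auto simp: graph_aut_def Bij_def bij_betw_def)
      then have fg: "f (g v) = h (f v)" if "v \<in> V" for v
      proof -
        obtain w where "h (f v) = f w" using hV[OF \<open>v \<in> V\<close>] by blast
        then show ?thesis using \<open>v \<in> V\<close> by (simp add: g_def ff)
      qed
      have "bij_betw (inv_into UNIV f \<circ> h \<circ> f) V V"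
        using h bf bi by (auto simp: graph_aut_def Bij_def intro!: bij_betw_trans)
      then have "g \<in> Bij V" by (simp add: Bij_def g_def)
      moreover have "{g u, g v} \<in> E \<longleftrightarrow> {u, v} \<in> E" if "u \<in> V" "v \<in> V" for u v
        using h that by (simp add: graph_aut_def fg flip: edge)
      ultimately have "g \<in> carrier (graph_aut V E)" by (simp add: graph_aut_def)
      moreover have "h = ?conj g"
      proof (rule extensionalityI[of _ "f ` V"])
        show "h \<in> extensional (f ` V)" using h by (simp add: graph_aut_def Bij_def)
      qed (auto simp: fg ff)
      ultimately show "h \<in> ?conj ` carrier (graph_aut V E)" by blast
    qed
  qed
qed

lemma card_orbits_image:
  assumes F: "inj F" and carrier: "carrier G' = \<psi> ` carrier G"
    and equivariant: "\<And>g x. x \<in> X \<Longrightarrow> \<phi>' (\<psi> g) (F x) = F (\<phi> g x)"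
  shows "card (orbits G' (F ` X) \<phi>') = card (orbits G X \<phi>)"
proof -
  have "orbit G' \<phi>' (F x) = F ` orbit G \<phi> x" if "x \<in> X" for x
    unfolding orbit_def carrier Setcompr_eq_image image_image
    using equivariant[OF that] by simp
  then have "orbits G' (F ` X) \<phi>' = (`) F ` orbits G X \<phi>"
    by (auto simp: orbits_def)
  moreover have "inj_on ((`) F) (orbits G X \<phi>)"
    by (rule inj_on_subset[OF inj_image_operator[OF F] subset_UNIV])
  ultimately show ?thesis by (simp add: card_image)
qed

lemma num_vertex_orbits_image:
  assumes f: "inj f"
  shows "num_vertex_orbits (f ` V) ((`) f ` E) = num_vertex_orbits V E"
  unfolding num_vertex_orbits_def
  by (rule card_orbits_image[OF f graph_aut_image[OF f]]) (use f in auto)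

lemma num_edge_orbits_image:
  assumes f: "inj f" and E: "\<And>e. e \<in> E \<Longrightarrow> e \<subseteq> V"
  shows "num_edge_orbits (f ` V) ((`) f ` E) = num_edge_orbits V E"
  unfolding num_edge_orbits_def
proof (rule card_orbits_image[OF inj_image_operator[OF f] graph_aut_image[OF f]])
  fix g e assume "e \<in> E"
  then have "e \<subseteq> V" by (rule E)
  then show "restrict (f \<circ> g \<circ> inv_into UNIV f) (f ` V) ` f ` e = f ` g ` e"
    unfolding image_image by (intro image_cong refl) (use f in auto)
qed

section \<open>Functions on an odd cycle\<close>

definition cycle_adj :: "nat \<Rightarrow> nat \<Rightarrow> nat \<Rightarrow> bool" where
  "cycle_adj n i j \<longleftrightarrow> [j = i + 1] (mod n) \<or> [i = j + 1] (mod n)"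

lemma cycle_adj_sym: "cycle_adj n i j \<longleftrightarrow> cycle_adj n j i"
  by (auto simp: cycle_adj_def)

lemma cycle_adj_rotate: "cycle_adj n ((i + k) mod n) ((j + k) mod n) \<longleftrightarrow> cycle_adj n i j"
proof -
  have "[(j + k) mod n = (i + k) mod n + 1] (mod n) \<longleftrightarrow> [j = i + 1] (mod n)" for i j
  proof -
    have "[(j + k) mod n = (i + k) mod n + 1] (mod n) \<longleftrightarrow> [j + k = (i + 1) + k] (mod n)"
      by (simp add: cong_def mod_simps ac_simps)
    then show ?thesis by (simp only: cong_add_rcancel_nat)
  qed
  then show ?thesis by (simp add: cycle_adj_def)
qed

lemma not_cycle_adj_refl:
  assumes "n \<ge> 3"
  shows "\<not> cycle_adj n i i"
proof -
  have "\<not> [i + 1 = i] (mod n)"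
    unfolding cong_add_lcancel_0_nat using assms by (simp add: cong_def)
  then show ?thesis by (auto simp: cycle_adj_def dest: cong_sym)
qed

text \<open>
Shifting the base point by one avoids a predecessor function: the neighbours of \<open>k + 1\<close> are \<open>k\<close> and \<open>k + 2\<close>.
\<close>
lemma sum_cycle_neighbours:
  fixes f :: "nat \<Rightarrow> real"
  assumes n: "n \<ge> 3"
  shows "(\<Sum>j | j < n \<and> cycle_adj n ((k + 1) mod n) j. f j) = f (k mod n) + f ((k + 2) mod n)"
proof -
  have "j < n \<and> cycle_adj n ((k + 1) mod n) j \<longleftrightarrow> j = k mod n \<or> j = (k + 2) mod n" for j
  proof -
    have "[(k + 1) mod n = j + 1] (mod n) \<longleftrightarrow> [k = j] (mod n)"
      using cong_add_rcancel_nat[of k 1 j n] by (simp add: cong_def)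
    moreover have "[j = (k + 1) mod n + 1] (mod n) \<longleftrightarrow> [j = k + 2] (mod n)"
      by (simp add: cong_def mod_simps)
    ultimately show ?thesis using n by (auto simp: cycle_adj_def cong_def)
  qed
  then have nb: "{j. j < n \<and> cycle_adj n ((k + 1) mod n) j} = {k mod n, (k + 2) mod n}"
    by auto
  have "k mod n \<noteq> (k + 2) mod n"
  proof
    assume "k mod n = (k + 2) mod n"
    then have "n dvd 2" using mod_eq_dvd_iff_nat[of k "k + 2" n] by simp
    then show False using n by (auto dest: dvd_imp_le)
  qed
  then show ?thesis unfolding nb by simp
qed

lemma card_cycle_neighbours:
  assumes "n \<ge> 3" "i < n"
  shows "card {j. j < n \<and> cycle_adj n i j} = 2"
proof -
  have "((i + n - 1) + 1) mod n = i" using assms by simp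
  then show ?thesis
    using sum_cycle_neighbours[OF assms(1), of "\<lambda>_. 1" "i + n - 1"] by simp
qed

text \<open>
The hypothesis says \<open>f(k + 2) = - f(k)\<close>; after \<open>n\<close> such steps one is back at \<open>k\<close> with the sign \<open>(-1)\<^sup>n = -1\<close>.
\<close>
lemma cycle_sum_zero_imp_zero:
  fixes f :: "nat \<Rightarrow> real"
  assumes n: "odd n" "n \<ge> 3"
    and zero: "\<And>i. i < n \<Longrightarrow> (\<Sum>j | j < n \<and> cycle_adj n i j. f j) = 0" and i: "i < n"
  shows "f i = 0"
proof -
  have step: "f ((k + 2) mod n) = - f (k mod n)" for k
    using zero[of "(k + 1) mod n"] sum_cycle_neighbours[OF n(2), of f k] n(2) by simp
  have "f ((i + 2 * j) mod n) = (- 1) ^ j * f i" for j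
  proof (induction j)
    case (Suc j)
    then show ?case using step[of "i + 2 * j"] by simp
  qed (use i in simp)
  from this[of n] have "f i = - f i" using n(1) i by simp
  then show ?thesis by simp
qed

text \<open>
Along multiples of \<open>s\<close> the function is an arithmetic progression, and a periodic one has increment 0.
\<close>
lemma periodic_arithmetic_imp_shift_invariant:
  fixes F :: "nat \<Rightarrow> real"
  assumes n: "n > 0" and period: "\<And>k. F (k + n * s) = F k"
    and arith: "\<And>k. F k + F (k + 2 * s) = 2 * F (k + s)"
  shows "F (k + s) = F k"
proof -
  have diff: "F (k + (j + 1) * s) - F (k + j * s) = F (k + s) - F k" for j
  proof (induction j)
    case (Suc j)
    then show ?case using arith[of "k + j * s"] by (simp add: algebra_simps mult_2_right)
  qed simp
  have "F (k + j * s) = F k + real j * (F (k + s) - F k)" for j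
  proof (induction j)
    case (Suc j)
    then show ?case using diff[of j] by (simp add: algebra_simps)
  qed simp
  from this[of n] have "real n * (F (k + s) - F k) = 0" using period[of k] by simp
  then show ?thesis using n by simp
qed

lemma cycle_harmonic_imp_constant:
  fixes f :: "nat \<Rightarrow> real"
  assumes n: "n \<ge> 3"
    and harm: "\<And>i. i < n \<Longrightarrow> (\<Sum>j | j < n \<and> cycle_adj n i j. f j) = 2 * f i"
    and i: "i < n"
  shows "f i = f 0"
proof -
  define F where "F k = f (k mod n)" for k
  have arith: "F k + F (k + 2 * 1) = 2 * F (k + 1)" for k
    using harm[of "(k + 1) mod n"] sum_cycle_neighbours[OF n, of f k] n by (simp add: F_def)
  have "F (k + n * 1) = F k" for k by (simp add: F_def)
  then have "F (k + 1) = F k" for k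
    using n by (intro periodic_arithmetic_imp_shift_invariant[OF _ _ arith, of n]) auto
  then have "F k = F 0" for k by (induction k) auto
  from this[of i] show ?thesis using i by (simp add: F_def)
qed

text \<open>
Here the arithmetic progressions have step 2, so \<open>F\<close> is invariant under shifts by 2; since
\<open>n\<close> is odd, shifting by \<open>n + 1\<close> shows that it is invariant under shifts by 1.
\<close>
lemma cycle_squared_harmonic_imp_constant:
  fixes f :: "nat \<Rightarrow> real"
  assumes n: "odd n" "n \<ge> 3"
    and harm: "\<And>i. i < n \<Longrightarrow>
      (\<Sum>j | j < n \<and> cycle_adj n i j. \<Sum>k | k < n \<and> cycle_adj n j k. f k) = 4 * f i"
    and i: "i < n"
  shows "f i = f 0"
proof -
  define F where "F k = f (k mod n)" for k
  have inner: "(\<Sum>l | l < n \<and> cycle_adj n ((k + 1) mod n) l. f l) = F k + F (k + 2)" for k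
    using sum_cycle_neighbours[OF n(2), of f k] by (simp add: F_def)
  have arith: "F k + F (k + 2 * 2) = 2 * F (k + 2)" for k
  proof -
    have "4 * F (k + 2) = (\<Sum>j | j < n \<and> cycle_adj n ((k + 1 + 1) mod n) j.
        \<Sum>l | l < n \<and> cycle_adj n j l. f l)"
      using harm[of "(k + 2) mod n"] n(2) by (simp add: F_def)
    also have "\<dots> = (F k + F (k + 2)) + (F (k + 2) + F (k + 2 + 2))"
      using sum_cycle_neighbours[OF n(2), of "\<lambda>j. \<Sum>l | l < n \<and> cycle_adj n j l. f l" "k + 1"]
        inner[of k] inner[of "k + 2"] by (simp add: numeral_eq_Suc)
    finally show ?thesis by (simp add: numeral_eq_Suc)
  qed
  have "F (k + n * 2) = F k" for k by (simp add: F_def)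
  then have two: "F (k + 2) = F k" for k
    using n(2) by (intro periodic_arithmetic_imp_shift_invariant[OF _ _ arith, of n]) auto
  have even: "F (k + 2 * j) = F k" for k j
  proof (induction j)
    case (Suc j)
    then show ?case using two[of "k + 2 * j"] by simp
  qed simp
  obtain h where h: "n = 2 * h + 1" using n(1) by (auto elim: oddE)
  have "F (k + 1) = F k" for k
  proof -
    have "F k = F (k + n)" by (simp add: F_def)
    also have "\<dots> = F (k + 1 + 2 * h)" by (simp add: h)
    also have "\<dots> = F (k + 1)" by (rule even)
    finally show ?thesis ..
  qed
  then have "F k = F 0" for k by (induction k) auto
  from this[of i] show ?thesis using i by (simp add: F_def)
qed

section \<open>The fibred graph over an odd cycle\<close>

lemma bij_betw_map_sum:
  assumes "bij_betw f A C" "bij_betw g B D"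
  shows "bij_betw (map_sum f g) (A <+> B) (C <+> D)"
proof (rule bij_betw_imageI)
  show "inj_on (map_sum f g) (A <+> B)"
    using assms[THEN bij_betw_imp_inj_on]
    by (intro inj_onI) (auto elim!: PlusE dest: inj_onD)
  show "map_sum f g ` (A <+> B) = C <+> D"
    unfolding bij_betw_imp_surj_on[OF assms(1), symmetric] bij_betw_imp_surj_on[OF assms(2), symmetric]
    by (simp add: Plus_def image_Un image_image)
qed

lemma bij_betw_rotate:
  assumes "n > 0"
  shows "bij_betw (\<lambda>i. (i + k) mod n) {..<n} {..<n::nat}"
proof -
  have "inj_on (\<lambda>i. (i + k) mod n) {..<n}"
  proof (rule inj_onI)
    fix i j assume "i \<in> {..<n}" "j \<in> {..<n}" "(i + k) mod n = (j + k) mod n"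
    then show "i = j" using cong_add_rcancel_nat[of i k j n] by (simp add: cong_def)
  qed
  moreover have "(\<lambda>i. (i + k) mod n) ` {..<n} \<subseteq> {..<n}" using assms by auto
  ultimately show ?thesis by (simp add: bij_betw_def endo_inj_surj)
qed

fun fibred_adj where
  "fibred_adj P R Q S (i, Inl a) (j, Inl b) \<longleftrightarrow> P i j \<and> R a b"
| "fibred_adj P R Q S (i, Inr a) (j, Inr b) \<longleftrightarrow> Q i j \<and> S a b"
| "fibred_adj P R Q S (i, Inl a) (j, Inr b) \<longleftrightarrow> i = j"
| "fibred_adj P R Q S (i, Inr a) (j, Inl b) \<longleftrightarrow> i = j"

text \<open>
The flag \<open>thin\<close> distinguishes \<open>\<kappa> = 2\<close>, where \<open>T\<close>-vertices are joined inside their fibre, from \<open>\<kappa> = 4\<close>, where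
they are joined along the cycle.  In both cases \<open>\<kappa> = 2 * (if thin then 1 else 2)\<close>.
\<close>
definition layer_adj :: "bool \<Rightarrow> nat \<Rightarrow> nat \<Rightarrow> nat \<Rightarrow> bool" where
  "layer_adj thin n i j \<longleftrightarrow> (if thin then i = j else cycle_adj n i j)"

locale fibred_graph =
  M: arc_transitive_nonsingular M R d + T: arc_transitive_nonsingular T S e
  for M :: "'a set" and R d and T :: "'b set" and S e +
  fixes n :: nat and thin :: bool
  assumes n_odd: "odd n" and n_ge3: "n \<ge> 3"
    and M_nonempty: "M \<noteq> {}" and T_nonempty: "T \<noteq> {}"
    and thin_irrefl: "\<And>c. \<lbrakk>thin; c \<in> T\<rbrakk> \<Longrightarrow> \<not> S c c"
    and balance: "2 * (if thin then 1 else 2) * d * e = card M * card T"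
    and degrees: "card T + 2 * d \<noteq> card M + (if thin then 1 else 2) * e"
begin

definition V :: "(nat \<times> ('a + 'b)) set" where
  "V = {..<n} \<times> (M <+> T)"

definition adj :: "nat \<times> ('a + 'b) \<Rightarrow> nat \<times> ('a + 'b) \<Rightarrow> bool" where
  "adj = fibred_adj (cycle_adj n) R (layer_adj thin n) S"

lemma adj_simps [simp]:
  "adj (i, Inl a) (j, Inl b) \<longleftrightarrow> cycle_adj n i j \<and> R a b"
  "adj (i, Inr c) (j, Inr c') \<longleftrightarrow> layer_adj thin n i j \<and> S c c'"
  "adj (i, Inl a) (j, Inr c) \<longleftrightarrow> i = j"
  "adj (i, Inr c) (j, Inl a) \<longleftrightarrow> i = j"
  by (simp_all add: adj_def)

lemma V_simps [simp]:
  "(i, Inl a) \<in> V \<longleftrightarrow> i < n \<and> a \<in> M"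
  "(i, Inr c) \<in> V \<longleftrightarrow> i < n \<and> c \<in> T"
  by (auto simp: V_def)

lemma V_cases:
  assumes "v \<in> V"
  obtains (Inl) i a where "v = (i, Inl a)" "i < n" "a \<in> M"
    | (Inr) i c where "v = (i, Inr c)" "i < n" "c \<in> T"
  using assms by (auto simp: V_def)

lemma finite_V: "finite V"
  using M.finite T.finite by (simp add: V_def)

lemma card_V: "card V = n * (card M + card T)"
  using M.finite T.finite by (simp add: V_def card_cartesian_product card_Plus)

lemma layer_adj_sym: "layer_adj thin n i j \<longleftrightarrow> layer_adj thin n j i"
  by (auto simp: layer_adj_def cycle_adj_sym)

lemma adj_sym:
  assumes "u \<in> V" "v \<in> V" "adj u v"
  shows "adj v u"
  using assms by (auto elim!: V_cases simp: cycle_adj_sym layer_adj_sym intro: M.sym T.sym)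

lemma adj_irrefl:
  assumes "v \<in> V"
  shows "\<not> adj v v"
  using assms thin_irrefl not_cycle_adj_refl[OF n_ge3]
  by (auto elim!: V_cases simp: layer_adj_def split: if_splits)

lemma sum_neighbours_Inl:
  fixes y :: "nat \<times> ('a + 'b) \<Rightarrow> real"
  assumes "i < n" "a \<in> M"
  shows "(\<Sum>u | u \<in> V \<and> adj (i, Inl a) u. y u) =
    (\<Sum>b | b \<in> M \<and> R a b. \<Sum>j | j < n \<and> cycle_adj n i j. y (j, Inl b)) + (\<Sum>c\<in>T. y (i, Inr c))"
proof -
  let ?B = "{b. b \<in> M \<and> R a b}" and ?J = "{j. j < n \<and> cycle_adj n i j}"
  have "{u. u \<in> V \<and> adj (i, Inl a) u} = (\<lambda>(b, j). (j, Inl b)) ` (?B \<times> ?J) \<union> (\<lambda>c. (i, Inr c)) ` T"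
    using assms by (auto elim!: V_cases)
  moreover have "(\<lambda>(b, j). (j, Inl b)) ` (?B \<times> ?J) \<inter> (\<lambda>c. (i, Inr c)) ` T = {}" by auto
  ultimately have "(\<Sum>u | u \<in> V \<and> adj (i, Inl a) u. y u) =
    (\<Sum>u\<in>(\<lambda>(b, j). (j, Inl b)) ` (?B \<times> ?J). y u) + (\<Sum>u\<in>(\<lambda>c. (i, Inr c)) ` T. y u)"
    using M.finite T.finite by (simp add: sum.union_disjoint)
  then show ?thesis
    by (simp add: sum.reindex inj_on_def sum.cartesian_product split_beta)
qed

lemma sum_neighbours_Inr:
  fixes y :: "nat \<times> ('a + 'b) \<Rightarrow> real"
  assumes "i < n" "c \<in> T"
  shows "(\<Sum>u | u \<in> V \<and> adj (i, Inr c) u. y u) =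
    (\<Sum>b | b \<in> T \<and> S c b. \<Sum>j | j < n \<and> layer_adj thin n i j. y (j, Inr b)) + (\<Sum>a\<in>M. y (i, Inl a))"
proof -
  let ?B = "{b. b \<in> T \<and> S c b}" and ?J = "{j. j < n \<and> layer_adj thin n i j}"
  have "{u. u \<in> V \<and> adj (i, Inr c) u} = (\<lambda>(b, j). (j, Inr b)) ` (?B \<times> ?J) \<union> (\<lambda>a. (i, Inl a)) ` M"
    using assms by (auto elim!: V_cases)
  moreover have "(\<lambda>(b, j). (j, Inr b)) ` (?B \<times> ?J) \<inter> (\<lambda>a. (i, Inl a)) ` M = {}" by auto
  ultimately have "(\<Sum>u | u \<in> V \<and> adj (i, Inr c) u. y u) =
    (\<Sum>u\<in>(\<lambda>(b, j). (j, Inr b)) ` (?B \<times> ?J). y u) + (\<Sum>u\<in>(\<lambda>a. (i, Inl a)) ` M. y u)"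
    using M.finite T.finite by (simp add: sum.union_disjoint)
  then show ?thesis
    by (simp add: sum.reindex inj_on_def sum.cartesian_product split_beta)
qed

lemma card_layer_neighbours:
  assumes "i < n"
  shows "card {j. j < n \<and> layer_adj thin n i j} = (if thin then 1 else 2)"
proof (cases thin)
  case True
  then have "{j. j < n \<and> layer_adj thin n i j} = {i}" using assms by (auto simp: layer_adj_def)
  then show ?thesis using True by simp
qed (use card_cycle_neighbours[OF n_ge3 assms] in \<open>simp add: layer_adj_def\<close>)

lemma degree:
  assumes "v \<in> V"
  shows "card {u \<in> V. adj v u} =
    (if isl (snd v) then card T + 2 * d else card M + (if thin then 1 else 2) * e)"
  using assms
proof (cases rule: V_cases)
  case (Inl i a)
  have "real (card {u \<in> V. adj v u}) = (\<Sum>u | u \<in> V \<and> adj v u. 1)" by simp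
  also have "\<dots> = real (card T + 2 * d)"
    unfolding Inl(1) sum_neighbours_Inl[OF Inl(2,3)]
    using card_cycle_neighbours[OF n_ge3 Inl(2)] M.valency[OF Inl(3)] by simp
  finally show ?thesis using Inl(1) by (simp only: of_nat_eq_iff) simp
next
  case (Inr i c)
  have "real (card {u \<in> V. adj v u}) = (\<Sum>u | u \<in> V \<and> adj v u. 1)" by simp
  also have "\<dots> = real (card M + (if thin then 1 else 2) * e)"
    unfolding Inr(1) sum_neighbours_Inr[OF Inr(2,3)]
    using card_layer_neighbours[OF Inr(2)] T.valency[OF Inr(3)] by simp
  finally show ?thesis using Inr(1) by (simp only: of_nat_eq_iff) simp
qed

lemma layer_sum_zero_imp_zero:
  fixes f :: "nat \<Rightarrow> real"
  assumes "\<And>i. i < n \<Longrightarrow> (\<Sum>j | j < n \<and> layer_adj thin n i j. f j) = 0" and i: "i < n"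
  shows "f i = 0"
proof (cases thin)
  case True
  then have "{j. j < n \<and> layer_adj thin n i j} = {i}" using i by (auto simp: layer_adj_def)
  then show ?thesis using assms(1)[OF i] by simp
next
  case False
  then have "layer_adj thin n = cycle_adj n" by (intro ext) (simp add: layer_adj_def)
  then show ?thesis
    using cycle_sum_zero_imp_zero[OF n_odd n_ge3 _ i] assms(1) by simp
qed

text \<open>
By nonsingularity of \<open>R\<close>, the sum of a null vector over the two neighbouring fibres is the same number for every
point of \<open>M\<close>.  The difference of the values at two points of \<open>M\<close> is then in the kernel of
the odd cycle, hence zero.  The argument for \<open>T\<close> is the same.
\<close>
lemma kernel_values:
  fixes y :: "nat \<times> ('a + 'b) \<Rightarrow> real"
  assumes ker: "\<And>v. v \<in> V \<Longrightarrow> (\<Sum>u | u \<in> V \<and> adj v u. y u) = 0"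
  obtains \<alpha> \<beta> :: "nat \<Rightarrow> real" where
    "\<And>i a. \<lbrakk>i < n; a \<in> M\<rbrakk> \<Longrightarrow> y (i, Inl a) = \<alpha> i"
    "\<And>i c. \<lbrakk>i < n; c \<in> T\<rbrakk> \<Longrightarrow> y (i, Inr c) = \<beta> i"
    "\<And>i. i < n \<Longrightarrow> d * (\<Sum>j | j < n \<and> cycle_adj n i j. \<alpha> j) + card T * \<beta> i = 0"
    "\<And>i. i < n \<Longrightarrow> e * (\<Sum>j | j < n \<and> layer_adj thin n i j. \<beta> j) + card M * \<alpha> i = 0"
proof -
  obtain a0 c0 where a0: "a0 \<in> M" and c0: "c0 \<in> T"
    using M_nonempty T_nonempty by blast
  have d0: "real d \<noteq> 0" and e0: "real e \<noteq> 0"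
    using M.valency_pos T.valency_pos by auto
  have M_eq: "(\<Sum>b | b \<in> M \<and> R a b. \<Sum>j | j < n \<and> cycle_adj n i j. y (j, Inl b)) +
      (\<Sum>c\<in>T. y (i, Inr c)) = 0" if "i < n" "a \<in> M" for i a
    using ker[of "(i, Inl a)"] sum_neighbours_Inl[OF that, of y] that by simp
  have T_eq: "(\<Sum>b | b \<in> T \<and> S c b. \<Sum>j | j < n \<and> layer_adj thin n i j. y (j, Inr b)) +
      (\<Sum>a\<in>M. y (i, Inl a)) = 0" if "i < n" "c \<in> T" for i c
    using ker[of "(i, Inr c)"] sum_neighbours_Inr[OF that, of y] that by simp
  have M_sum: "(\<Sum>j | j < n \<and> cycle_adj n i j. y (j, Inl b)) = - (\<Sum>c\<in>T. y (i, Inr c)) / d"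
    if i: "i < n" and b: "b \<in> M" for i b
  proof -
    \<comment> \<open>Spreading the contribution of \<open>T\<close> evenly over the \<open>d\<close> neighbours makes the equations homogeneous.\<close>
    let ?x = "\<lambda>b. (\<Sum>j | j < n \<and> cycle_adj n i j. y (j, Inl b)) + (\<Sum>c\<in>T. y (i, Inr c)) / d"
    have "?x b = 0"
    proof (rule M.nonsingular[OF _ b])
      fix a assume a: "a \<in> M"
      show "(\<Sum>b | b \<in> M \<and> R a b. ?x b) = 0"
        using M_eq[OF i a] M.valency[OF a] d0 by (simp add: sum.distrib)
    qed
    then show ?thesis by simp
  qed
  have T_sum: "(\<Sum>j | j < n \<and> layer_adj thin n i j. y (j, Inr b)) = - (\<Sum>a\<in>M. y (i, Inl a)) / e"
    if i: "i < n" and b: "b \<in> T" for i b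
  proof -
    let ?x = "\<lambda>b. (\<Sum>j | j < n \<and> layer_adj thin n i j. y (j, Inr b)) + (\<Sum>a\<in>M. y (i, Inl a)) / e"
    have "?x b = 0"
    proof (rule T.nonsingular[OF _ b])
      fix c assume c: "c \<in> T"
      show "(\<Sum>b | b \<in> T \<and> S c b. ?x b) = 0"
        using T_eq[OF i c] T.valency[OF c] e0 by (simp add: sum.distrib)
    qed
    then show ?thesis by simp
  qed
  define \<alpha> where "\<alpha> i = y (i, Inl a0)" for i
  define \<beta> where "\<beta> i = y (i, Inr c0)" for i
  have \<alpha>: "y (i, Inl a) = \<alpha> i" if "i < n" "a \<in> M" for i a
    using cycle_sum_zero_imp_zero[OF n_odd n_ge3 _ that(1), of "\<lambda>i. y (i, Inl a) - y (i, Inl a0)"]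
      M_sum a0 that(2) by (simp add: sum_subtractf \<alpha>_def)
  have \<beta>: "y (i, Inr c) = \<beta> i" if "i < n" "c \<in> T" for i c
    using layer_sum_zero_imp_zero[OF _ that(1), of "\<lambda>i. y (i, Inr c) - y (i, Inr c0)"]
      T_sum c0 that(2) by (simp add: sum_subtractf \<beta>_def)
  show ?thesis
  proof
    fix i assume i: "i < n"
    have "(\<Sum>c\<in>T. y (i, Inr c)) = card T * \<beta> i" using \<beta>[OF i] by simp
    then show "d * (\<Sum>j | j < n \<and> cycle_adj n i j. \<alpha> j) + card T * \<beta> i = 0"
      using M_sum[OF i a0] d0 by (simp add: \<alpha>_def)
    have "(\<Sum>a\<in>M. y (i, Inl a)) = card M * \<alpha> i" using \<alpha>[OF i] by simp
    then show "e * (\<Sum>j | j < n \<and> layer_adj thin n i j. \<beta> j) + card M * \<alpha> i = 0"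
      using T_sum[OF i c0] e0 by (simp add: \<beta>_def)
  qed (use \<alpha> \<beta> in auto)
qed

text \<open>
Eliminating \<open>\<beta>\<close> gives \<open>d e (C \<alpha>) = |M| |T| \<alpha>\<close> in the thin case and \<open>d e (C (C \<alpha>)) = |M| |T| \<alpha>\<close>
otherwise, where \<open>C\<close> is the cycle operator.  By \<open>balance\<close> the factor \<open>|M| |T| / (d e)\<close> is 2 or 4,
which is the largest eigenvalue of \<open>C\<close> or of its square, and on an odd cycle the eigenvectors are the constants.
\<close>
lemma fibre_values_constant:
  fixes \<alpha> \<beta> :: "nat \<Rightarrow> real"
  assumes M_eq: "\<And>i. i < n \<Longrightarrow> d * (\<Sum>j | j < n \<and> cycle_adj n i j. \<alpha> j) + card T * \<beta> i = 0"
    and T_eq: "\<And>i. i < n \<Longrightarrow> e * (\<Sum>j | j < n \<and> layer_adj thin n i j. \<beta> j) + card M * \<alpha> i = 0"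
    and i: "i < n"
  shows "\<alpha> i = \<alpha> 0"
proof -
  have de: "real d * real e \<noteq> 0" using M.valency_pos T.valency_pos by simp
  have bal: "real (card M) * real (card T) = 2 * (if thin then 1 else 2) * real d * real e"
    using arg_cong[OF balance, of real] by (cases thin) simp_all
  have compose: "(d * e) * (\<Sum>k | k < n \<and> layer_adj thin n i k. \<Sum>j | j < n \<and> cycle_adj n k j. \<alpha> j) =
      (card M * card T) * \<alpha> i" if i: "i < n" for i
  proof -
    have "(d * e) * (\<Sum>k | k < n \<and> layer_adj thin n i k. \<Sum>j | j < n \<and> cycle_adj n k j. \<alpha> j) =
      e * (\<Sum>k | k < n \<and> layer_adj thin n i k. d * (\<Sum>j | j < n \<and> cycle_adj n k j. \<alpha> j))"
      by (simp add: sum_distrib_left mult_ac)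
    also have "(\<Sum>k | k < n \<and> layer_adj thin n i k. d * (\<Sum>j | j < n \<and> cycle_adj n k j. \<alpha> j)) =
      (\<Sum>k | k < n \<and> layer_adj thin n i k. - card T * \<beta> k)"
      using M_eq by (intro sum.cong refl) (simp add: eq_neg_iff_add_eq_0)
    also have "e * \<dots> = - card T * (e * (\<Sum>k | k < n \<and> layer_adj thin n i k. \<beta> k))"
      by (simp add: sum_distrib_left sum_negf mult_ac)
    also have "e * (\<Sum>k | k < n \<and> layer_adj thin n i k. \<beta> k) = - card M * \<alpha> i"
      using T_eq[OF i] by simp
    finally show ?thesis by (simp add: mult_ac)
  qed
  show ?thesis
  proof (cases thin)
    case True
    have "(\<Sum>j | j < n \<and> cycle_adj n i j. \<alpha> j) = 2 * \<alpha> i" if i: "i < n" for i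
    proof -
      have "{k. k < n \<and> layer_adj thin n i k} = {i}" using True i by (auto simp: layer_adj_def)
      then have "(real d * real e) * (\<Sum>j | j < n \<and> cycle_adj n i j. \<alpha> j) = (real d * real e) * (2 * \<alpha> i)"
        using compose[OF i] bal True by simp
      then show ?thesis using de by (simp only: mult_cancel_left) simp
    qed
    then show ?thesis using cycle_harmonic_imp_constant[OF n_ge3 _ i] by blast
  next
    case False
    have "(\<Sum>k | k < n \<and> cycle_adj n i k. \<Sum>j | j < n \<and> cycle_adj n k j. \<alpha> j) = 4 * \<alpha> i"
      if i: "i < n" for i
    proof -
      have "layer_adj thin n = cycle_adj n" using False by (intro ext) (simp add: layer_adj_def)
      then have "(real d * real e) * (\<Sum>k | k < n \<and> cycle_adj n i k. \<Sum>j | j < n \<and> cycle_adj n k j. \<alpha> j) =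
        (real d * real e) * (4 * \<alpha> i)"
        using compose[OF i] bal False by simp
      then show ?thesis using de by (simp only: mult_cancel_left) simp
    qed
    then show ?thesis using cycle_squared_harmonic_imp_constant[OF n_odd n_ge3 _ i] by blast
  qed
qed

definition null_vector :: "nat \<times> ('a + 'b) \<Rightarrow> real" where
  "null_vector v = (if isl (snd v) then card T else - 2 * d)"

text \<open>
The equation at an \<open>M\<close>-vertex determines the ratio of the two values, and \<open>balance\<close> is the equation at a \<open>T\<close>-vertex.
\<close>
lemma null_vector_in_kernel:
  assumes "v \<in> V"
  shows "(\<Sum>u | u \<in> V \<and> adj v u. null_vector u) = 0"
  using assms
proof (cases rule: V_cases)
  case (Inl i a)
  show ?thesis
    unfolding Inl(1) sum_neighbours_Inl[OF Inl(2,3)]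
    using card_cycle_neighbours[OF n_ge3 Inl(2)] M.valency[OF Inl(3)]
    by (simp add: null_vector_def)
next
  case (Inr i c)
  have "2 * real (if thin then 1 else 2) * d * e = card M * card T"
    using arg_cong[OF balance, of real] by simp
  then show ?thesis
    unfolding Inr(1) sum_neighbours_Inr[OF Inr(2,3)]
    using card_layer_neighbours[OF Inr(2)] T.valency[OF Inr(3)]
    by (simp add: null_vector_def mult_ac)
qed

lemma kernel_iff:
  fixes y :: "nat \<times> ('a + 'b) \<Rightarrow> real"
  shows "(\<forall>v\<in>V. (\<Sum>u | u \<in> V \<and> adj v u. y u) = 0) \<longleftrightarrow> (\<exists>k. \<forall>v\<in>V. y v = k * null_vector v)"
proof
  assume "\<forall>v\<in>V. (\<Sum>u | u \<in> V \<and> adj v u. y u) = 0"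
  then obtain \<alpha> \<beta> :: "nat \<Rightarrow> real" where val:
    "\<And>i a. \<lbrakk>i < n; a \<in> M\<rbrakk> \<Longrightarrow> y (i, Inl a) = \<alpha> i"
    "\<And>i c. \<lbrakk>i < n; c \<in> T\<rbrakk> \<Longrightarrow> y (i, Inr c) = \<beta> i"
    and eqs:
    "\<And>i. i < n \<Longrightarrow> d * (\<Sum>j | j < n \<and> cycle_adj n i j. \<alpha> j) + card T * \<beta> i = 0"
    "\<And>i. i < n \<Longrightarrow> e * (\<Sum>j | j < n \<and> layer_adj thin n i j. \<beta> j) + card M * \<alpha> i = 0"
    using kernel_values[of y] by blast
  have t0: "real (card T) \<noteq> 0" using T.finite T_nonempty by simp
  have \<alpha>: "\<alpha> i = \<alpha> 0" if "i < n" for i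
    by (rule fibre_values_constant[OF eqs that])
  have \<beta>: "card T * \<beta> i = - 2 * d * \<alpha> 0" if i: "i < n" for i
  proof -
    have "(\<Sum>j | j < n \<and> cycle_adj n i j. \<alpha> j) = (\<Sum>j | j < n \<and> cycle_adj n i j. \<alpha> 0)"
      by (rule sum.cong[OF refl]) (rule \<alpha>, simp)
    then show ?thesis using eqs(1)[OF i] card_cycle_neighbours[OF n_ge3 i] by simp
  qed
  have "y v = \<alpha> 0 / card T * null_vector v" if "v \<in> V" for v
    using that
  proof (cases rule: V_cases)
    case (Inl i a)
    then show ?thesis using val(1)[OF Inl(2,3)] \<alpha>[OF Inl(2)] t0 by (simp add: null_vector_def)
  next
    case (Inr i c)
    then show ?thesis using val(2)[OF Inr(2,3)] \<beta>[OF Inr(2)] t0 by (simp add: null_vector_def field_simps)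
  qed
  then show "\<exists>k. \<forall>v\<in>V. y v = k * null_vector v" by blast
next
  assume "\<exists>k. \<forall>v\<in>V. y v = k * null_vector v"
  then obtain k where k: "\<And>v. v \<in> V \<Longrightarrow> y v = k * null_vector v" by blast
  show "\<forall>v\<in>V. (\<Sum>u | u \<in> V \<and> adj v u. y u) = 0"
  proof
    fix v assume v: "v \<in> V"
    have "(\<Sum>u | u \<in> V \<and> adj v u. y u) = (\<Sum>u | u \<in> V \<and> adj v u. k * null_vector u)"
      using k by (intro sum.cong) auto
    also have "\<dots> = 0"
      using null_vector_in_kernel[OF v] by (simp flip: sum_distrib_left)
    finally show "(\<Sum>u | u \<in> V \<and> adj v u. y u) = 0" .
  qed
qed

lemma edge_iff: "{u, v} \<in> edge_set V adj \<longleftrightarrow> u \<in> V \<and> v \<in> V \<and> adj u v"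
  by (rule edge_set_iff[OF adj_sym])

lemma V_nonempty: "V \<noteq> {}"
  using M_nonempty n_ge3 by (auto simp: V_def lessThan_empty_iff)

theorem nut_graph_V: "nut_graph V (edge_set V adj)"
proof (rule nut_graphI[of _ _ null_vector])
  show "finite_simple_graph V (edge_set V adj)"
    by (rule finite_simple_graph_edge_set[OF finite_V adj_irrefl])
  show "null_vector v \<noteq> 0" if "v \<in> V" for v
    using M.valency_pos T.finite T_nonempty by (simp add: null_vector_def)
  fix y :: "nat \<times> ('a + 'b) \<Rightarrow> real"
  have "{u. u \<in> V \<and> {v, u} \<in> edge_set V adj} = {u. u \<in> V \<and> adj v u}" if "v \<in> V" for v
    using that by (auto simp: edge_iff)
  then show "(\<forall>v\<in>V. (\<Sum>u | u \<in> V \<and> {v, u} \<in> edge_set V adj. y u) = 0) \<longleftrightarrow>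
      (\<exists>k. \<forall>v\<in>V. y v = k * null_vector v)"
    using kernel_iff[of y] by simp
qed (rule V_nonempty)

definition move :: "nat \<Rightarrow> ('a \<Rightarrow> 'a) \<Rightarrow> ('b \<Rightarrow> 'b) \<Rightarrow> nat \<times> ('a + 'b) \<Rightarrow> nat \<times> ('a + 'b)" where
  "move k g h = map_prod (\<lambda>i. (i + k) mod n) (map_sum g h)"

lemma move_aut:
  assumes g: "g \<in> relation_auts M R" and h: "h \<in> relation_auts T S"
  shows "move k g h \<in> relation_auts V adj"
proof -
  have rot: "bij_betw (\<lambda>i. (i + k) mod n) {..<n} {..<n}"
    using n_ge3 by (intro bij_betw_rotate) simp
  have rot_eq: "(i + k) mod n = (j + k) mod n \<longleftrightarrow> i = j" if "i < n" "j < n" for i j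
    using inj_on_eq_iff[OF bij_betw_imp_inj_on[OF rot], of i j] that by simp
  have layer: "layer_adj thin n ((i + k) mod n) ((j + k) mod n) \<longleftrightarrow> layer_adj thin n i j"
    if "i < n" "j < n" for i j
    using rot_eq[OF that] by (simp add: layer_adj_def cycle_adj_rotate)
  have "bij_betw (move k g h) V V"
    unfolding move_def V_def using g h
    by (intro bij_betw_map_prod rot bij_betw_map_sum) (simp_all add: relation_auts_def)
  moreover have "adj (move k g h u) (move k g h v) \<longleftrightarrow> adj u v" if uv: "u \<in> V" "v \<in> V" for u v
    using uv g h
    by (auto elim!: V_cases simp: move_def relation_auts_def cycle_adj_rotate layer rot_eq)
  ultimately show ?thesis by (simp add: relation_auts_def)
qed

text \<open>
The two sides are told apart by their degrees, which differ by the assumption \<open>degrees\<close>.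
\<close>
lemma aut_preserves_side:
  assumes g: "g \<in> relation_auts V adj" and v: "v \<in> V"
  shows "isl (snd (g v)) = isl (snd v)"
proof -
  have bij: "bij_betw g V V" and pres: "\<And>u v. \<lbrakk>u \<in> V; v \<in> V\<rbrakk> \<Longrightarrow> adj (g u) (g v) \<longleftrightarrow> adj u v"
    using g by (auto simp: relation_auts_def)
  have gv: "g v \<in> V" using bij v by (auto simp: bij_betw_def)
  have surj: "g ` V = V" using bij by (rule bij_betw_imp_surj_on)
  have "{w \<in> V. adj (g v) w} = g ` {u \<in> V. adj v u}"
  proof (intro Set.set_eqI iffI)
    fix w assume w: "w \<in> {w \<in> V. adj (g v) w}"
    then obtain u where "u \<in> V" "w = g u" using surj by blast
    then show "w \<in> g ` {u \<in> V. adj v u}" using w pres[OF v] by blast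
  next
    fix w assume "w \<in> g ` {u \<in> V. adj v u}"
    then show "w \<in> {w \<in> V. adj (g v) w}" using pres[OF v] surj by blast
  qed
  then have "card {w \<in> V. adj (g v) w} = card {u \<in> V. adj v u}"
    using inj_on_subset[OF bij_betw_imp_inj_on[OF bij], of "{u \<in> V. adj v u}"]
    by (simp add: card_image)
  then show ?thesis
    using degree[OF gv] degree[OF v] degrees by (auto split: if_splits)
qed

lemma carrier_graph_aut: "carrier (graph_aut V (edge_set V adj)) = relation_auts V adj \<inter> extensional V"
  by (rule graph_aut_edge_set[OF adj_sym])

lemma move_in_graph_aut:
  assumes "g \<in> relation_auts M R" "h \<in> relation_auts T S"
  shows "restrict (move k g h) V \<in> carrier (graph_aut V (edge_set V adj))"
  using relation_aut_in_graph_aut[OF adj_sym move_aut[OF assms]] .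

lemma rotation_exists:
  assumes "i < n" "i' < n"
  obtains k where "\<And>s. ((i + s) mod n + k) mod n = (i' + s) mod n"
proof
  fix s
  have "((i + s) mod n + (i' + (n - i))) mod n = (i + s + (i' + (n - i))) mod n"
    by (rule mod_add_left_eq)
  also have "i + s + (i' + (n - i)) = i' + s + n" using assms by simp
  finally show "((i + s) mod n + (i' + (n - i))) mod n = (i' + s) mod n" by simp
qed

theorem num_vertex_orbits_V: "num_vertex_orbits V (edge_set V adj) = 2"
proof -
  obtain a0 c0 where a0: "a0 \<in> M" and c0: "c0 \<in> T"
    using M_nonempty T_nonempty by blast
  have "num_vertex_orbits V (edge_set V adj) = card ((isl \<circ> snd) ` V)"
    unfolding num_vertex_orbits_def
  proof (rule card_orbits_eq_card_colours)
    fix g v assume "g \<in> carrier (graph_aut V (edge_set V adj))" "v \<in> V"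
    then show "g v \<in> V \<and> (isl \<circ> snd) (g v) = (isl \<circ> snd) v"
      using aut_preserves_side[of g v]
      by (auto simp: carrier_graph_aut relation_auts_def bij_betw_def)
  next
    fix u v assume uv: "u \<in> V" "v \<in> V" "(isl \<circ> snd) u = (isl \<circ> snd) v"
    obtain i x where u: "u = (i, x)" by (cases u)
    obtain j z where v: "v = (j, z)" by (cases v)
    have "i < n" "j < n" using uv by (auto simp: u v V_def)
    then obtain k where k: "\<And>s. ((i + s) mod n + k) mod n = (j + s) mod n"
      using rotation_exists by blast
    have k0: "(i + k) mod n = j" using k[of 0] \<open>i < n\<close> \<open>j < n\<close> by simp
    obtain g h where gh: "g \<in> relation_auts M R" "h \<in> relation_auts T S" "map_sum g h x = z"
    proof (cases x)
      case (Inl a)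
      then obtain b where z: "z = Inl b" using uv(3) by (cases z) (auto simp: u v)
      obtain g where "g \<in> relation_auts M R" "g a = b"
        using M.vertex_transitive[of a b] uv by (auto simp: u v Inl z)
      moreover obtain h where "h \<in> relation_auts T S" using T.vertex_transitive[OF c0 c0] by blast
      ultimately show ?thesis using that Inl z by auto
    next
      case (Inr a)
      then obtain b where z: "z = Inr b" using uv(3) by (cases z) (auto simp: u v)
      obtain h where "h \<in> relation_auts T S" "h a = b"
        using T.vertex_transitive[of a b] uv by (auto simp: u v Inr z)
      moreover obtain g where "g \<in> relation_auts M R" using M.vertex_transitive[OF a0 a0] by blast
      ultimately show ?thesis using that Inr z by auto
    qed
    have "restrict (move k g h) V u = v" using uv(1) gh(3) k0 by (simp add: move_def u v)
    then show "\<exists>f\<in>carrier (graph_aut V (edge_set V adj)). f u = v"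
      using move_in_graph_aut[OF gh(1,2)] by blast
  qed
  also have "(isl \<circ> snd) ` V = {True, False}"
  proof -
    have mem: "(0, Inl a0) \<in> V" "(0, Inr c0) \<in> V" using a0 c0 n_ge3 by auto
    have "True \<in> (isl \<circ> snd) ` V" using mem(1) by (rule rev_image_eqI) simp
    moreover have "False \<in> (isl \<circ> snd) ` V" using mem(2) by (rule rev_image_eqI) simp
    ultimately show ?thesis by auto
  qed
  finally show ?thesis by simp
qed

text \<open>
Every edge inside one of the two sides can be written so that it points forward along the cycle.  Hence
rotations of the cycle and automorphisms of \<open>R\<close> and \<open>S\<close> move any edge to any other edge of its kind.
\<close>
lemma edge_cases:
  assumes "E \<in> edge_set V adj"
  obtains (M) i a b where "i < n" "a \<in> M" "b \<in> M" "R a b" "E = {(i, Inl a), ((i + 1) mod n, Inl b)}"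
    | (T) i c c' where "i < n" "c \<in> T" "c' \<in> T" "S c c'"
        "E = {(i, Inr c), ((i + (if thin then 0 else 1)) mod n, Inr c')}"
    | (MT) i a c where "i < n" "a \<in> M" "c \<in> T" "E = {(i, Inl a), (i, Inr c)}"
proof -
  have cyc: "j = (i + 1) mod n \<or> i = (j + 1) mod n" if "cycle_adj n i j" "i < n" "j < n" for i j
    using that by (auto simp: cycle_adj_def cong_def)
  obtain u v where uv: "u \<in> V" "v \<in> V" "adj u v" "E = {u, v}"
    using assms by (auto simp: edge_set_def)
  from uv(1) show ?thesis
  proof (cases rule: V_cases)
    case u: (Inl i a)
    from uv(2) show ?thesis
    proof (cases rule: V_cases)
      case v: (Inl j b)
      have "R a b" "cycle_adj n i j" using uv(3) u v by auto
      then have "R b a" using M.sym u v by blast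
      from cyc[OF \<open>cycle_adj n i j\<close> u(2) v(2)] show ?thesis
      proof
        assume "j = (i + 1) mod n"
        then show ?thesis using M[of i a b] u v uv(4) \<open>R a b\<close> by simp
      next
        assume "i = (j + 1) mod n"
        then show ?thesis using M[of j b a] u v uv(4) \<open>R b a\<close> by (simp add: insert_commute)
      qed
    next
      case v: (Inr j c)
      then show ?thesis using MT[of i a c] u uv by simp
    qed
  next
    case u: (Inr i c)
    from uv(2) show ?thesis
    proof (cases rule: V_cases)
      case v: (Inl j a)
      then show ?thesis using MT[of i a c] u uv by (simp add: insert_commute)
    next
      case v: (Inr j c')
      have "S c c'" "layer_adj thin n i j" using uv(3) u v by auto
      then have "S c' c" using T.sym u v by blast
      have "j = (i + (if thin then 0 else 1)) mod n \<or> i = (j + (if thin then 0 else 1)) mod n"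
        using \<open>layer_adj thin n i j\<close> cyc[of i j] u(2) v(2) by (simp add: layer_adj_def split: if_splits)
      then show ?thesis
      proof
        assume "j = (i + (if thin then 0 else 1)) mod n"
        then show ?thesis using T[of i c c'] u v uv(4) \<open>S c c'\<close> by simp
      next
        assume "i = (j + (if thin then 0 else 1)) mod n"
        then show ?thesis using T[of j c' c] u v uv(4) \<open>S c' c\<close> by (simp add: insert_commute)
      qed
    qed
  qed
qed

theorem num_edge_orbits_V: "num_edge_orbits V (edge_set V adj) = 3"
proof -
  let ?c = "\<lambda>E. (isl \<circ> snd) ` E"
  obtain a0 c0 where a0: "a0 \<in> M" and c0: "c0 \<in> T"
    using M_nonempty T_nonempty by blast
  obtain b0 where b0: "b0 \<in> M" "R a0 b0" using M.neighbour_exists[OF a0] by blast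
  obtain c1 where c1: "c1 \<in> T" "S c0 c1" using T.neighbour_exists[OF c0] by blast
  have "num_edge_orbits V (edge_set V adj) = card (?c ` edge_set V adj)"
    unfolding num_edge_orbits_def
  proof (rule card_orbits_eq_card_colours)
    fix g E assume g: "g \<in> carrier (graph_aut V (edge_set V adj))" and "E \<in> edge_set V adj"
    then obtain u v where uv: "u \<in> V" "v \<in> V" "adj u v" "E = {u, v}"
      by (auto simp: edge_set_def)
    have g': "g \<in> relation_auts V adj" using g by (simp add: carrier_graph_aut)
    then have "g u \<in> V" "g v \<in> V" "adj (g u) (g v)"
      using uv by (auto simp: relation_auts_def bij_betw_def)
    then have "g ` E \<in> edge_set V adj" using uv(4) by (simp add: edge_iff)
    moreover have "?c (g ` E) = ?c E"
      using uv aut_preserves_side[OF g'] by simp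
    ultimately show "g ` E \<in> edge_set V adj \<and> ?c (g ` E) = ?c E" by blast
  next
    fix E E' assume E: "E \<in> edge_set V adj" and E': "E' \<in> edge_set V adj" and col: "?c E = ?c E'"
    have sub: "E \<subseteq> V" using E by (auto simp: edge_set_def)
    have moved: "\<exists>f\<in>carrier (graph_aut V (edge_set V adj)). f ` E = E'"
      if "g \<in> relation_auts M R" "h \<in> relation_auts T S" "move k g h ` E = E'" for k g h
    proof -
      have "restrict (move k g h) V ` E = move k g h ` E"
        using sub by (intro image_cong) auto
      then show ?thesis using move_in_graph_aut[OF that(1,2)] that(3) by blast
    qed
    from E show "\<exists>f\<in>carrier (graph_aut V (edge_set V adj)). f ` E = E'"
    proof (cases rule: edge_cases)
      case e: (M i a b)
      from E' obtain j a' b' where e': "j < n" "a' \<in> M" "b' \<in> M" "R a' b'"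
        "E' = {(j, Inl a'), ((j + 1) mod n, Inl b')}"
        by (cases rule: edge_cases) (use col e(5) in auto)
      obtain k where k: "\<And>s. ((i + s) mod n + k) mod n = (j + s) mod n"
        using rotation_exists e(1) e'(1) by blast
      obtain g where g: "g \<in> relation_auts M R" "g a = a'" "g b = b'"
        using M.arc_transitive e e' by metis
      obtain h where h: "h \<in> relation_auts T S" using T.vertex_transitive[OF c0 c0] by blast
      have "move k g h ` E = E'"
        using k[of 0] k[of 1] e(1,5) e'(1,5) g by (simp add: move_def)
      then show ?thesis using moved[OF g(1) h] by blast
    next
      case e: (T i c c')
      let ?s = "if thin then 0 else 1 :: nat"
      from E' obtain j a' b' where e': "j < n" "a' \<in> T" "b' \<in> T" "S a' b'"
        "E' = {(j, Inr a'), ((j + ?s) mod n, Inr b')}"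
        by (cases rule: edge_cases) (use col e(5) in auto)
      obtain k where k: "\<And>s. ((i + s) mod n + k) mod n = (j + s) mod n"
        using rotation_exists e(1) e'(1) by blast
      obtain h where h: "h \<in> relation_auts T S" "h c = a'" "h c' = b'"
        using T.arc_transitive e e' by metis
      obtain g where g: "g \<in> relation_auts M R" using M.vertex_transitive[OF a0 a0] by blast
      have "move k g h ` E = E'"
        using k[of 0] k[of ?s] e(1,5) e'(1,5) h by (simp add: move_def)
      then show ?thesis using moved[OF g h(1)] by blast
    next
      case e: (MT i a c)
      from E' obtain j a' c' where e': "j < n" "a' \<in> M" "c' \<in> T" "E' = {(j, Inl a'), (j, Inr c')}"
        by (cases rule: edge_cases) (use col e(4) in auto)
      obtain k where k: "\<And>s. ((i + s) mod n + k) mod n = (j + s) mod n"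
        using rotation_exists e(1) e'(1) by blast
      obtain g where g: "g \<in> relation_auts M R" "g a = a'"
        using M.vertex_transitive e(2) e'(2) by blast
      obtain h where h: "h \<in> relation_auts T S" "h c = c'"
        using T.vertex_transitive e(3) e'(3) by blast
      have "move k g h ` E = E'"
        using k[of 0] e(1,4) e'(1,4) g h by (simp add: move_def)
      then show ?thesis using moved[OF g(1) h(1)] by blast
    qed
  qed
  also have "?c ` edge_set V adj = {{True}, {False}, {True, False}}"
  proof
    show "?c ` edge_set V adj \<subseteq> {{True}, {False}, {True, False}}"
      by (auto elim!: edge_cases)
    have "{(0, Inl a0), (1, Inl b0)} \<in> edge_set V adj"
      using a0 b0 n_ge3 by (simp add: edge_iff cycle_adj_def cong_def)
    moreover have "{(0, Inl a0), (0, Inr c0)} \<in> edge_set V adj"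
      using a0 c0 n_ge3 by (simp add: edge_iff)
    moreover have "{(0, Inr c0), (if thin then 0 else 1, Inr c1)} \<in> edge_set V adj"
      using c0 c1 n_ge3 by (simp add: edge_iff layer_adj_def cycle_adj_def cong_def)
    ultimately show "{{True}, {False}, {True, False}} \<subseteq> ?c ` edge_set V adj"
      by (auto simp: image_iff intro: bexI[rotated])
  qed
  finally show ?thesis by (simp add: doubleton_eq_iff)
qed

end

section \<open>Attainable orders and valencies\<close>

text \<open>
The flag records whether the relation can be chosen without loops, as is required for the
\<open>T\<close>-side when \<open>\<kappa> = 2\<close>.
\<close>
definition realised :: "bool \<Rightarrow> nat \<Rightarrow> nat \<Rightarrow> bool" where
  "realised loopless k d \<longleftrightarrow> (\<exists>R. arc_transitive_nonsingular {..<k} R d \<and>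
     (loopless \<longrightarrow> (\<forall>a<k. \<not> R a a)))"

lemma realised_loops: "realised False k 1"
  unfolding realised_def by (blast intro: arc_transitive_nonsingular_eq)

lemma realised_complete:
  assumes "k \<ge> 2"
  shows "realised loopless k (k - 1)"
  unfolding realised_def using arc_transitive_nonsingular_neq[of "{..<k}"] assms by auto

lemma realised_circulant:
  assumes "prime p" "even d" "d dvd p - 1"
  shows "realised loopless p d"
proof -
  have "p > 1" using assms(1) prime_gt_1_nat by blast
  moreover have "d > 0" using assms(3) \<open>p > 1\<close> by (auto intro!: Nat.gr0I)
  ultimately have "\<not> [(int a - int a) ^ d = 1] (mod int p)" for a
    by (simp add: cong_def power_0_left)
  then show ?thesis
    unfolding realised_def using arc_transitive_nonsingular_circulant[OF assms] by blast
qed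

lemma realised_mult:
  assumes "realised l1 k1 d1" "realised l2 k2 d2"
  shows "realised (l1 \<or> l2) (k1 * k2) (d1 * d2)"
proof -
  obtain R S where R: "arc_transitive_nonsingular {..<k1} R d1" "l1 \<longrightarrow> (\<forall>a<k1. \<not> R a a)"
    and S: "arc_transitive_nonsingular {..<k2} S d2" "l2 \<longrightarrow> (\<forall>a<k2. \<not> S a a)"
    using assms by (auto simp: realised_def)
  have "card {..<k1 * k2} = card ({..<k1} \<times> {..<k2})" by simp
  then obtain h where h: "bij_betw h {..<k1 * k2} ({..<k1} \<times> {..<k2})"
    using finite_same_card_bij by (metis finite_lessThan finite_cartesian_product)
  have "fst (h a) < k1 \<and> snd (h a) < k2" if "a < k1 * k2" for a
    using bij_betwE[OF h] that by (simp add: mem_Times_iff)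
  then show ?thesis
    unfolding realised_def
    using arc_transitive_nonsingular_vimage[OF arc_transitive_nonsingular_tensor[OF R(1) S(1)] h] R(2) S(2)
    by blast
qed

lemma realised_prod:
  assumes "finite A" "\<And>i. i \<in> A \<Longrightarrow> realised True (k i) (d i)"
  shows "realised (A \<noteq> {}) (\<Prod>i\<in>A. k i) (\<Prod>i\<in>A. d i)"
  using assms
proof (induction A rule: finite_induct)
  case empty
  then show ?case using realised_loops[of 1] by simp
next
  case (insert x A)
  then show ?case using realised_mult[of True "k x" "d x" "A \<noteq> {}"] by simp
qed

lemma realised_product:
  fixes r q :: nat
  assumes "\<And>i. i \<in> {1..r} \<Longrightarrow> prime (p i) \<and> even (d i) \<and> d i dvd p i - 1"
    and "\<And>i. i \<in> {1..q} \<Longrightarrow> c i \<ge> 2"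
  shows "realised (r > 0 \<or> q > 0) (k * (\<Prod>i=1..r. p i) * (\<Prod>i=1..q. c i))
    ((\<Prod>i=1..r. d i) * (\<Prod>i=1..q. c i - 1))"
proof -
  have 1: "realised ({1..r} \<noteq> {}) (\<Prod>i=1..r. p i) (\<Prod>i=1..r. d i)"
    using assms(1) by (intro realised_prod realised_circulant) auto
  have 2: "realised ({1..q} \<noteq> {}) (\<Prod>i=1..q. c i) (\<Prod>i=1..q. c i - 1)"
    using assms(2) by (intro realised_prod realised_complete) auto
  have "r > 0 \<or> q > 0 \<longleftrightarrow> (False \<or> {1..r} \<noteq> {}) \<or> {1..q} \<noteq> {}" by auto
  then show ?thesis
    using realised_mult[OF realised_mult[OF realised_loops[of k] 1] 2] by simp
qed

section \<open>Nut graphs with two vertex orbits and three edge orbits\<close>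

lemma nut_graph_of_realised:
  assumes n: "odd n" "n \<ge> 3" and pos: "m > 0" "t > 0"
    and m: "realised loopless m d" and t: "realised thin t e"
    and balance: "2 * (if thin then 1 else 2) * d * e = m * t"
    and degrees: "t + 2 * d \<noteq> m + (if thin then 1 else 2) * e"
  shows "\<exists>(V :: nat set) E. nut_graph V E \<and> num_vertex_orbits V E = 2 \<and>
    num_edge_orbits V E = 3 \<and> card V = n * (m + t)"
proof -
  obtain R S where R: "arc_transitive_nonsingular {..<m} R d"
    and S: "arc_transitive_nonsingular {..<t} S e" "thin \<longrightarrow> (\<forall>a<t. \<not> S a a)"
    using m t by (auto simp: realised_def)
  interpret G: fibred_graph "{..<m}" R d "{..<t}" S e n thin
    by (rule fibred_graph.intro[OF R S(1)], unfold_locales)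
      (use n pos S(2) balance degrees in \<open>auto simp: lessThan_empty_iff\<close>)
  let ?E = "edge_set G.V G.adj"
  let ?f = "to_nat :: nat \<times> (nat + nat) \<Rightarrow> nat"
  have f: "inj ?f" by simp
  show ?thesis
  proof (intro exI conjI)
    show "nut_graph (?f ` G.V) ((`) ?f ` ?E)"
      by (rule nut_graph_image[OF f G.nut_graph_V])
    show "num_vertex_orbits (?f ` G.V) ((`) ?f ` ?E) = 2"
      using num_vertex_orbits_image[OF f] G.num_vertex_orbits_V by simp
    show "num_edge_orbits (?f ` G.V) ((`) ?f ` ?E) = 3"
    proof -
      have "A \<subseteq> G.V" if "A \<in> ?E" for A using that by (auto simp: edge_set_def)
      then show ?thesis using num_edge_orbits_image[OF f, of ?E G.V] G.num_edge_orbits_V by simp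
    qed
    show "card (?f ` G.V) = n * (m + t)"
      using G.card_V by (simp add: card_image inj_on_subset[OF f])
  qed
qed

text \<open>
For \<open>\<kappa> = 2\<close> the relation on \<open>T\<close> has to be loopless, which the given factorization does not provide
when \<open>T\<close> has no prime or complete factor.  In that case \<open>e = 1\<close> and \<open>2 D = m t\<close>, which forces \<open>m = 1\<close>
and \<open>t = 2\<close>, and a single edge on the two points takes the place of the identity relation.
\<close>
lemma nut_graph_of_factorisations:
  fixes r1 q1 r2 q2 :: nat
  assumes n: "odd n" "n \<ge> 3" and m0: "m \<ge> 1" and t0: "t \<ge> 2"
    and mp: "\<And>i. i \<in> {1..r1} \<Longrightarrow> prime (mp i) \<and> even (d i) \<and> d i dvd mp i - 1"
    and tp: "\<And>i. i \<in> {1..r2} \<Longrightarrow> prime (tp i) \<and> even (d' i) \<and> d' i dvd tp i - 1"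
    and mc: "\<And>i. i \<in> {1..q1} \<Longrightarrow> mc i \<ge> 2"
    and tc: "\<And>i. i \<in> {1..q2} \<Longrightarrow> tc i \<ge> 2"
    and m: "m = m0 * (\<Prod>i=1..r1. mp i) * (\<Prod>i=1..q1. mc i)"
    and t: "t = t0 * (\<Prod>i=1..r2. tp i) * (\<Prod>i=1..q2. tc i)"
    and \<kappa>: "\<kappa> \<in> {2, 4}"
    and balance: "\<kappa> * (\<Prod>i=1..r1. d i) * (\<Prod>j=1..r2. d' j)
             * (\<Prod>i=1..q1. mc i - 1) * (\<Prod>i=1..q2. tc i - 1) = m * t"
    and degrees: "t + 2 * (\<Prod>i=1..r1. d i) * (\<Prod>i=1..q1. mc i - 1)
             \<noteq> m + (\<kappa> div 2) * (\<Prod>j=1..r2. d' j) * (\<Prod>i=1..q2. tc i - 1)"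
  shows "\<exists>(V :: nat set) E. nut_graph V E \<and> num_vertex_orbits V E = 2 \<and>
    num_edge_orbits V E = 3 \<and> card V = n * (m + t)"
proof -
  define D where "D = (\<Prod>i=1..r1. d i) * (\<Prod>i=1..q1. mc i - 1)"
  define e where "e = (\<Prod>i=1..r2. d' i) * (\<Prod>i=1..q2. tc i - 1)"
  have D: "realised (r1 > 0 \<or> q1 > 0) m D"
    unfolding m D_def by (rule realised_product[OF mp mc])
  have e: "realised (r2 > 0 \<or> q2 > 0) t e"
    unfolding t e_def by (rule realised_product[OF tp tc])
  have bal: "\<kappa> * D * e = m * t" using balance by (simp add: D_def e_def mult_ac)
  have deg: "t + 2 * D \<noteq> m + \<kappa> div 2 * e" using degrees by (simp add: D_def e_def mult_ac)
  note build = nut_graph_of_realised[OF n _ _ D]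
  show ?thesis
  proof (cases "\<kappa> = 4")
    case True
    moreover have "realised False t e" using e by (auto simp: realised_def)
    ultimately show ?thesis using build[of t False e] m0 t0 bal deg by simp
  next
    case False
    then have \<kappa>2: "\<kappa> = 2" using \<kappa> by simp
    have "realised True t e"
    proof (cases "r2 > 0 \<or> q2 > 0")
      case True
      then show ?thesis using e by simp
    next
      case False
      then have e1: "e = 1" by (simp add: e_def)
      have "m * 2 \<le> m * t" using t0 by simp
      \<comment> \<open>A relation of valency at least \<open>m\<close> on \<open>m\<close> points has loops, so the \<open>M\<close>-side has no loopless factor either.\<close>
      then have "m \<le> D" using bal unfolding \<kappa>2 e1 by linarith
      obtain R where R: "arc_transitive_nonsingular {..<m} R D" "r1 > 0 \<or> q1 > 0 \<longrightarrow> (\<forall>a<m. \<not> R a a)"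
        using D by (auto simp: realised_def)
      have "R 0 0"
      proof (rule ccontr)
        assume "\<not> R 0 0"
        moreover have "0 \<in> {..<m}" using m0 by simp
        ultimately have "{b \<in> {..<m}. R 0 b} \<subset> {..<m}" by blast
        then have "card {b \<in> {..<m}. R 0 b} < card {..<m}"
          by (rule psubset_card_mono[OF finite_lessThan])
        moreover have "card {b \<in> {..<m}. R 0 b} = D"
          using \<open>0 \<in> {..<m}\<close> by (rule arc_transitive_nonsingular.valency[OF R(1)])
        ultimately show False using \<open>m \<le> D\<close> by simp
      qed
      then have "\<not> (r1 > 0 \<or> q1 > 0)" using R(2) m0 by (metis less_eq_Suc_le One_nat_def)
      then have "D = 1" by (simp add: D_def)
      then have "m * t = 2" using bal \<kappa>2 e1 by simp
      moreover have "t \<le> m * t" using m0 by simp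
      ultimately have "t = 2" using t0 by simp
      then show ?thesis using realised_complete[of 2 True] e1 by simp
    qed
    then show ?thesis using build[of t True e] m0 t0 bal deg \<kappa>2 by simp
  qed
qed

text \<open>
Each case names relations of orders \<open>m\<close> and \<open>t\<close> with \<open>m + t = s\<close>; the two remaining conditions are
numerical.  The loopless variant on the second side selects \<open>\<kappa> = 2\<close>.
\<close>
lemma nut_graph_of_listed_multiple:
  assumes n: "odd n" "n \<ge> 3"
    and s: "s \<in> {3,5,7,11,13,29,31,37,41,47,53,59,83,101,103,109,127,131,137,139}"
  shows "\<exists>(V :: nat set) E. nut_graph V E \<and> num_vertex_orbits V E = 2 \<and>
    num_edge_orbits V E = 3 \<and> card V = n * s"
proof -
  define P where "P s \<longleftrightarrow> (\<exists>(V :: nat set) E. nut_graph V E \<and> num_vertex_orbits V E = 2 \<and>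
    num_edge_orbits V E = 3 \<and> card V = n * s)" for s
  have build: "P (m + t)"
    if "realised loopless m d" "realised thin t e" "m > 0" "t > 0"
      "2 * (if thin then 1 else 2) * d * e = m * t"
      "t + 2 * d \<noteq> m + (if thin then 1 else 2) * e" for loopless m d thin t e
    unfolding P_def by (rule nut_graph_of_realised[OF n that(3,4,1,2,5,6)])
  have "P 3"
    using build[OF realised_loops[of 1]
      realised_complete[of 2 True]]
    by (simp add: numeral_3_eq_3)
  have "P 5"
    using build[OF realised_loops[of 1]
      realised_loops[of 4]]
    by simp
  have "P 7"
    using build[OF realised_loops[of 3]
      realised_complete[of 4 False]]
    by simp
  have "P 11"
    using build[OF realised_complete[of 3 False]
      realised_mult[OF realised_loops[of 2] realised_complete[of 4 False]]]
    by simp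
  have "P 13"
    using build[OF realised_loops[of 1]
      realised_mult[OF realised_loops[of 3] realised_complete[of 4 False]]]
    by simp
  have "P 29"
    using build[OF realised_mult[OF realised_loops[of 3] realised_complete[of 7 False]]
      realised_complete[of 8 False]]
    by simp
  have "P 31"
    using build[OF realised_complete[of 7 False]
      realised_mult[OF realised_loops[of 3] realised_complete[of 8 False]]]
    by simp
  have "P 37"
    using build[OF realised_mult[OF realised_complete[of 7 False] realised_complete[of 3 False]]
      realised_mult[OF realised_loops[of 2] realised_complete[of 8 False]]]
    by simp
  have "P 41"
    using build[OF realised_complete[of 9 False]
      realised_mult[OF realised_mult[OF realised_loops[of 2] realised_complete[of 4 False]] realised_complete[of 4 False]]]
    by simp
  have "P 47"
    using build[OF realised_mult[OF realised_complete[of 5 False] realised_complete[of 3 False]]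
      realised_mult[OF realised_loops[of 2] realised_complete[of 16 False]]]
    by simp
  have "P 53"
    using build[OF realised_complete[of 5 False]
      realised_mult[OF realised_loops[of 3] realised_complete[of 16 False]]]
    by simp
  have "P 59"
    using build[OF realised_loops[of 3]
      realised_mult[OF realised_complete[of 8 False] realised_complete[of 7 False]]]
    by simp
  have "P 83"
    using build[OF realised_loops[of 3]
      realised_mult[OF realised_complete[of 16 False] realised_complete[of 5 False]]]
    by simp
  have "P 101"
    using build[OF realised_complete[of 5 False]
      realised_mult[OF realised_mult[OF realised_loops[of 2] realised_complete[of 16 False]] realised_complete[of 3 False]]]
    by simp
  have "P 103"
    using build[OF realised_mult[OF realised_complete[of 11 False] realised_circulant[of 5 2 False]]
      realised_mult[OF realised_complete[of 12 False] realised_complete[of 4 False]]]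
    by simp
  have "P 109"
    using build[OF realised_mult[OF realised_complete[of 9 False] realised_circulant[of 5 2 False]]
      realised_mult[OF realised_complete[of 16 False] realised_complete[of 4 False]]]
    by simp
  have "P 127"
    using build[OF realised_complete[of 15 False]
      realised_mult[OF realised_complete[of 16 False] realised_circulant[of 7 2 False]]]
    by simp
  have "P 131"
    using build[OF realised_mult[OF realised_complete[of 7 False] realised_complete[of 5 False]]
      realised_mult[OF realised_mult[OF realised_loops[of 2] realised_complete[of 8 False]] realised_complete[of 6 False]]]
    by simp
  have "P 137"
    using build[OF realised_mult[OF realised_complete[of 21 False] realised_circulant[of 5 2 False]]
      realised_mult[OF realised_complete[of 8 False] realised_complete[of 4 False]]]
    by simp
  have "P 139"
    using build[OF realised_circulant[of 19 6 False]
      realised_mult[OF realised_complete[of 20 False] realised_complete[of 6 False]]]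
    by simp
  note all = \<open>P 3\<close> \<open>P 5\<close> \<open>P 7\<close> \<open>P 11\<close> \<open>P 13\<close> \<open>P 29\<close> \<open>P 31\<close> \<open>P 37\<close> \<open>P 41\<close> \<open>P 47\<close> \<open>P 53\<close> \<open>P 59\<close> \<open>P 83\<close> \<open>P 101\<close> \<open>P 103\<close> \<open>P 109\<close> \<open>P 127\<close> \<open>P 131\<close> \<open>P 137\<close> \<open>P 139\<close>
  have "P s" using s all by (elim insertE) simp_all
  then show ?thesis by (simp add: P_def)
qed

theorem corollary4p3:
  fixes n :: nat
  assumes "odd n" and "n \<ge> 3"
  shows
    "(\<forall>(m::nat) (t::nat) (r1::nat) (q1::nat) (r2::nat) (q2::nat) (m0::nat) (t0::nat)
       (mp :: nat \<Rightarrow> nat) (mc :: nat \<Rightarrow> nat) (tp :: nat \<Rightarrow> nat) (tc :: nat \<Rightarrow> nat).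
        odd m \<longrightarrow> m \<ge> 1 \<longrightarrow> even t \<longrightarrow> t \<ge> 2 \<longrightarrow>
        m0 \<ge> 1 \<longrightarrow> t0 \<ge> 1 \<longrightarrow>
        (\<forall>i\<in>{1..r1}. prime (mp i) \<and> odd (mp i)) \<longrightarrow>
        (\<forall>j\<in>{1..r2}. prime (tp j) \<and> odd (tp j)) \<longrightarrow>
        (\<forall>i\<in>{1..q1}. mc i \<ge> 2) \<longrightarrow>
        (\<forall>i\<in>{1..q2}. tc i \<ge> 2) \<longrightarrow>
        m = m0 * (\<Prod>i=1..r1. mp i) * (\<Prod>i=1..q1. mc i) \<longrightarrow>
        t = t0 * (\<Prod>i=1..r2. tp i) * (\<Prod>i=1..q2. tc i) \<longrightarrow>
        (\<exists>(d :: nat \<Rightarrow> nat) (d' :: nat \<Rightarrow> nat) (\<kappa>::nat).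
           (\<forall>i\<in>{1..r1}. even (d i) \<and> d i dvd mp i - 1) \<and>
           (\<forall>j\<in>{1..r2}. even (d' j) \<and> d' j dvd tp j - 1) \<and>
           \<kappa> \<in> {2, 4} \<and>
           \<kappa> * (\<Prod>i=1..r1. d i) * (\<Prod>j=1..r2. d' j)
             * (\<Prod>i=1..q1. mc i - 1) * (\<Prod>i=1..q2. tc i - 1) = m * t \<and>
           t + 2 * (\<Prod>i=1..r1. d i) * (\<Prod>i=1..q1. mc i - 1)
             \<noteq> m + (\<kappa> div 2) * (\<Prod>j=1..r2. d' j) * (\<Prod>i=1..q2. tc i - 1)) \<longrightarrow>
        (\<exists>(V :: nat set) E. nut_graph V E \<and> num_vertex_orbits V E = 2 \<and>
           num_edge_orbits V E = 3 \<and> card V = n * (m + t)))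
     \<and>
     (\<forall>s \<in> {3,5,7,11,13,29,31,37,41,47,53,59,83,101,103,109,127,131,137,139}.
        \<exists>(V :: nat set) E. nut_graph V E \<and> num_vertex_orbits V E = 2 \<and>
           num_edge_orbits V E = 3 \<and> card V = n * s)"
proof (intro conjI allI impI ballI; (elim exE conjE)?)
  fix m t r1 q1 r2 q2 m0 t0 :: nat and mp mc tp tc d d' :: "nat \<Rightarrow> nat" and \<kappa> :: nat
  assume "m \<ge> 1" "t \<ge> 2"
    and mp: "\<forall>i\<in>{1..r1}. prime (mp i) \<and> odd (mp i)"
    and tp: "\<forall>j\<in>{1..r2}. prime (tp j) \<and> odd (tp j)"
    and mc: "\<forall>i\<in>{1..q1}. mc i \<ge> 2" and tc: "\<forall>i\<in>{1..q2}. tc i \<ge> 2"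
    and m: "m = m0 * (\<Prod>i=1..r1. mp i) * (\<Prod>i=1..q1. mc i)"
    and t: "t = t0 * (\<Prod>i=1..r2. tp i) * (\<Prod>i=1..q2. tc i)"
    and d: "\<forall>i\<in>{1..r1}. even (d i) \<and> d i dvd mp i - 1"
    and d': "\<forall>j\<in>{1..r2}. even (d' j) \<and> d' j dvd tp j - 1"
    and "\<kappa> \<in> {2, 4}"
    and "\<kappa> * (\<Prod>i=1..r1. d i) * (\<Prod>j=1..r2. d' j)
      * (\<Prod>i=1..q1. mc i - 1) * (\<Prod>i=1..q2. tc i - 1) = m * t"
    and "t + 2 * (\<Prod>i=1..r1. d i) * (\<Prod>i=1..q1. mc i - 1)
      \<noteq> m + (\<kappa> div 2) * (\<Prod>j=1..r2. d' j) * (\<Prod>i=1..q2. tc i - 1)"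
  then show "\<exists>(V :: nat set) E. nut_graph V E \<and> num_vertex_orbits V E = 2 \<and>
      num_edge_orbits V E = 3 \<and> card V = n * (m + t)"
    by (intro nut_graph_of_factorisations[OF assms _ _ _ _ _ _ m t, of d d' \<kappa>]) auto
next
  fix s :: nat
  assume "s \<in> {3,5,7,11,13,29,31,37,41,47,53,59,83,101,103,109,127,131,137,139}"
  then show "\<exists>(V :: nat set) E. nut_graph V E \<and> num_vertex_orbits V E = 2 \<and>
      num_edge_orbits V E = 3 \<and> card V = n * s"
    by (rule nut_graph_of_listed_multiple[OF assms])
qed

end
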